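(* Let $\lambda$ be an infinite cardinal number. Then every closed ideal of $\mathscr{B}(\ell_\infty^c(\lambda))$ that contains the ideal of weakly compact operators is equal to $\mathscr{S}_{\ell_\infty^c(\kappa)}(\ell_\infty^c(\lambda))$ for some infinite cardinal number $\kappa\leqslant\lambda^+$.
   Context: Banach spaces are over a fixed scalar field, either $\mathbb{R}$ or $\mathbb{C}$. For an infinite cardinal $\lambda$, $\ell_\infty^c(\lambda)$ is the closed subspace of $\ell_\infty(\lambda)$ (bounded scalar functions on $\lambda$, supremum norm) consisting of all $z$ with $z(\alpha)\neq 0$ for at most countably many $\alpha<\lambda$ (so $\ell_\infty^c(\omega)=\ell_\infty$). $\lambda^+$ is the cardinal successor of $\lambda$. $\mathscr{B}(X)$ is the Banach algebra of bounded linear operators on $X$; ideals are two-sided. For Banach spaces $E$ and $X$, $\mathscr{S}_E(X)$ is the set of all $T\in\mathscr{B}(X)$ that are not bounded below on any copy of $E$, i.e. for which there is no subspace $E_0\subseteq X$ isomorphic (linearly homeomorphic) to $E$ and constant $c>0$ with $\|Tx\|\geqslant c\|x\|$ for all $x\in E_0$. *)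

theory Defs
  imports "HOL-Analysis.Analysis"
begin

section \<open>The Banach space of bounded, countably supported functions\<close>

text \<open>
  \<open>('a, 'k) linfc\<close> is the space of bounded functions with countable support on the index set
  \<open>UNIV :: 'a set\<close>, with the supremum norm.  The scalars \<open>'k\<close> are meant to be \<open>real\<close> or
  \<open>complex\<close>.
\<close>

typedef (overloaded) ('a, 'k::real_normed_field) linfc =
  "{z :: 'a \<Rightarrow> 'k. bounded (range z) \<and> countable {\<alpha>. z \<alpha> \<noteq> 0}}"
  morphisms coord Abs_linfc
  by (rule exI[of _ "\<lambda>_. 0"]) auto

setup_lifting type_definition_linfc

lemma linfc_eqI: "(\<And>\<alpha>. coord x \<alpha> = coord y \<alpha>) \<Longrightarrow> x = y"
  by (simp add: coord_inject[symmetric] fun_eq_iff)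

lift_definition scaleK :: "'k::real_normed_field \<Rightarrow> ('a, 'k) linfc \<Rightarrow> ('a, 'k) linfc"
    (infixr "*\<^sub>K" 75)
  is "\<lambda>c z \<alpha>. c * z \<alpha>"
proof -
  fix c :: 'k and z :: "'a \<Rightarrow> 'k"
  assume z: "bounded (range z) \<and> countable {\<alpha>. z \<alpha> \<noteq> 0}"
  have "bounded ((\<lambda>x. c * x) ` range z)"
    by (rule bounded_linear_image[OF _ bounded_linear_mult_right]) (use z in simp)
  moreover have "countable {\<alpha>. c * z \<alpha> \<noteq> 0}"
    by (rule countable_subset[of _ "{\<alpha>. z \<alpha> \<noteq> 0}"]) (use z in auto)
  ultimately show "bounded (range (\<lambda>\<alpha>. c * z \<alpha>)) \<and> countable {\<alpha>. c * z \<alpha> \<noteq> 0}"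
    by (simp add: image_image)
qed

instantiation linfc :: (type, real_normed_field) real_vector
begin

lift_definition zero_linfc :: "('a, 'b) linfc" is "\<lambda>_. 0"
  by auto

lift_definition uminus_linfc :: "('a, 'b) linfc \<Rightarrow> ('a, 'b) linfc" is "\<lambda>z \<alpha>. - z \<alpha>"
  by auto

lift_definition plus_linfc :: "('a, 'b) linfc \<Rightarrow> ('a, 'b) linfc \<Rightarrow> ('a, 'b) linfc"
  is "\<lambda>z w \<alpha>. z \<alpha> + w \<alpha>"
proof -
  fix z w :: "'a \<Rightarrow> 'b"
  assume z: "bounded (range z) \<and> countable {\<alpha>. z \<alpha> \<noteq> 0}"
    and w: "bounded (range w) \<and> countable {\<alpha>. w \<alpha> \<noteq> 0}"
  have "countable {\<alpha>. z \<alpha> + w \<alpha> \<noteq> 0}"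
    by (rule countable_subset[of _ "{\<alpha>. z \<alpha> \<noteq> 0} \<union> {\<alpha>. w \<alpha> \<noteq> 0}"]) (use z w in auto)
  then show "bounded (range (\<lambda>\<alpha>. z \<alpha> + w \<alpha>)) \<and> countable {\<alpha>. z \<alpha> + w \<alpha> \<noteq> 0}"
    using z w by (auto intro: bounded_plus_comp)
qed

lift_definition minus_linfc :: "('a, 'b) linfc \<Rightarrow> ('a, 'b) linfc \<Rightarrow> ('a, 'b) linfc"
  is "\<lambda>z w \<alpha>. z \<alpha> - w \<alpha>"
proof -
  fix z w :: "'a \<Rightarrow> 'b"
  assume z: "bounded (range z) \<and> countable {\<alpha>. z \<alpha> \<noteq> 0}"
    and w: "bounded (range w) \<and> countable {\<alpha>. w \<alpha> \<noteq> 0}"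
  have "countable {\<alpha>. z \<alpha> - w \<alpha> \<noteq> 0}"
    by (rule countable_subset[of _ "{\<alpha>. z \<alpha> \<noteq> 0} \<union> {\<alpha>. w \<alpha> \<noteq> 0}"]) (use z w in auto)
  then show "bounded (range (\<lambda>\<alpha>. z \<alpha> - w \<alpha>)) \<and> countable {\<alpha>. z \<alpha> - w \<alpha> \<noteq> 0}"
    using z w by (auto intro: bounded_minus_comp)
qed

lift_definition scaleR_linfc :: "real \<Rightarrow> ('a, 'b) linfc \<Rightarrow> ('a, 'b) linfc"
  is "\<lambda>r z \<alpha>. r *\<^sub>R z \<alpha>"
  by (auto intro: bounded_scaleR_comp elim: countable_subset[rotated])

lemmas linfc_rep_eqs [simp] =
  zero_linfc.rep_eq uminus_linfc.rep_eq plus_linfc.rep_eq minus_linfc.rep_eq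
  scaleR_linfc.rep_eq

instance
  by standard (auto intro!: linfc_eqI simp: algebra_simps)

end

lemma bdd_above_norm_coord: "bdd_above (range (\<lambda>\<alpha>. norm (coord z \<alpha>)))"
  using coord[of z] by (auto simp: bounded_iff bdd_above_def)

instantiation linfc :: (type, real_normed_field) real_normed_vector
begin

definition norm_linfc :: "('a, 'b) linfc \<Rightarrow> real"
  where "norm z = (SUP \<alpha>. norm (coord z \<alpha>))"

definition dist_linfc :: "('a, 'b) linfc \<Rightarrow> ('a, 'b) linfc \<Rightarrow> real"
  where "dist z w = norm (z - w)" for z w :: "('a, 'b) linfc"

definition sgn_linfc :: "('a, 'b) linfc \<Rightarrow> ('a, 'b) linfc"
  where "sgn z = z /\<^sub>R norm z" for z :: "('a, 'b) linfc"

definition uniformity_linfc :: "(('a, 'b) linfc \<times> ('a, 'b) linfc) filter"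
  where "uniformity_linfc = (INF e\<in>{0<..}. principal {(x, y). dist x y < e})"

definition open_linfc :: "('a, 'b) linfc set \<Rightarrow> bool"
  where "open_linfc U \<longleftrightarrow>
    (\<forall>x\<in>U. eventually (\<lambda>(x', y). x' = x \<longrightarrow> y \<in> U) uniformity)"

lemma norm_coord_le: "norm (coord z \<alpha>) \<le> norm z" for z :: "('a, 'b) linfc"
  unfolding norm_linfc_def by (rule cSUP_upper[OF UNIV_I bdd_above_norm_coord])

lemma norm_linfc_le: "(\<And>\<alpha>. norm (coord z \<alpha>) \<le> b) \<Longrightarrow> norm z \<le> b" for z :: "('a, 'b) linfc"
  unfolding norm_linfc_def by (rule cSUP_least) auto

instance
proof
  fix r :: real and z w :: "('a, 'b) linfc"
  show "norm z = 0 \<longleftrightarrow> z = 0"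
  proof
    assume "norm z = 0"
    then have "coord z \<alpha> = 0" for \<alpha>
      using norm_coord_le[of z \<alpha>] by simp
    then show "z = 0"
      by (intro linfc_eqI) simp
  qed (simp add: norm_linfc_def)
  show "norm (z + w) \<le> norm z + norm w"
    by (rule norm_linfc_le) (simp add: norm_triangle_mono norm_coord_le)
  have le: "norm (s *\<^sub>R v) \<le> \<bar>s\<bar> * norm v" for s :: real and v :: "('a, 'b) linfc"
    by (rule norm_linfc_le) (simp add: mult_left_mono norm_coord_le)
  show "norm (r *\<^sub>R z) = \<bar>r\<bar> * norm z"
  proof (cases "r = 0")
    case False
    have "norm z \<le> \<bar>inverse r\<bar> * norm (r *\<^sub>R z)"
      using le[of "inverse r" "r *\<^sub>R z"] False by simp
    then have "\<bar>r\<bar> * norm z \<le> norm (r *\<^sub>R z)"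
      using False by (simp add: field_simps)
    with le[of r z] show ?thesis by simp
  qed (simp add: norm_linfc_def)
qed (simp_all add: dist_linfc_def sgn_linfc_def uniformity_linfc_def open_linfc_def)

end

text \<open>
  For a cardinal \<open>\<kappa> :: 'b rel\<close> (a \<open>Card_order\<close>), the space of bounded, countably supported functions
  on \<open>\<kappa>\<close> is the space of functions on \<open>Field \<kappa>\<close>, realised as the functions on all of \<open>'b\<close> that
  vanish off \<open>Field \<kappa>\<close>.
\<close>

definition linfc_card :: "'b rel \<Rightarrow> ('b, 'k::real_normed_field) linfc set"
  where "linfc_card \<kappa> = {z. \<forall>\<alpha>. \<alpha> \<notin> Field \<kappa> \<longrightarrow> coord z \<alpha> = 0}"


section \<open>Operators, functionals and ideals\<close>

text \<open>
  The type \<open>\<Rightarrow>\<^sub>L\<close> consists of the bounded \<^emph>\<open>real\<close>-linear maps, so homogeneity over the scalar field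
  \<open>'k\<close> has to be required in addition (it is automatic for \<open>'k = real\<close>).
\<close>

definition operators :: "(('a, 'k::real_normed_field) linfc \<Rightarrow>\<^sub>L ('a, 'k) linfc) set"
  where "operators = {T :: ('a, 'k) linfc \<Rightarrow>\<^sub>L ('a, 'k) linfc. \<forall>c x. T (c *\<^sub>K x) = c *\<^sub>K T x}"

definition functionals :: "(('a, 'k::real_normed_field) linfc \<Rightarrow>\<^sub>L 'k) set"
  where "functionals = {\<phi> :: ('a, 'k) linfc \<Rightarrow>\<^sub>L 'k. \<forall>c x. \<phi> (c *\<^sub>K x) = c * \<phi> x}"

text \<open>
  Closure under scalar multiples follows from absorption of the scalar multiples of the identity.
\<close>

definition operator_ideal ::
    "(('a, 'k::real_normed_field) linfc \<Rightarrow>\<^sub>L ('a, 'k) linfc) set \<Rightarrow> bool"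
  where "operator_ideal I \<longleftrightarrow>
    I \<subseteq> operators \<and> 0 \<in> I \<and> (\<forall>S\<in>I. \<forall>T\<in>I. S + T \<in> I) \<and>
    (\<forall>T\<in>I. \<forall>A\<in>operators. A o\<^sub>L T \<in> I \<and> T o\<^sub>L A \<in> I)"

definition weak_topology :: "('a, 'k::real_normed_field) linfc topology"
  where "weak_topology =
    topology_generated_by
      {blinfun_apply \<phi> -` U | (\<phi> :: ('a, 'k) linfc \<Rightarrow>\<^sub>L 'k) U. \<phi> \<in> functionals \<and> open U}"

definition weakly_compact_operators ::
    "(('a, 'k::real_normed_field) linfc \<Rightarrow>\<^sub>L ('a, 'k) linfc) set"
  where "weakly_compact_operators =
    {T :: ('a, 'k) linfc \<Rightarrow>\<^sub>L ('a, 'k) linfc. T \<in> operators \<and>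
      compactin weak_topology (weak_topology closure_of (T ` cball 0 1))}"


section \<open>Operators not bounded below on any copy of a given space\<close>

definition K_subspace :: "('a, 'k::real_normed_field) linfc set \<Rightarrow> bool"
  where "K_subspace E \<longleftrightarrow>
    0 \<in> E \<and> (\<forall>x\<in>E. \<forall>y\<in>E. x + y \<in> E) \<and> (\<forall>c. \<forall>x\<in>E. c *\<^sub>K x \<in> E)"

definition isomorphic_spaces ::
    "('a, 'k::real_normed_field) linfc set \<Rightarrow> ('b, 'k) linfc set \<Rightarrow> bool"
  where "isomorphic_spaces E F \<longleftrightarrow>
    (\<exists>U V. homeomorphism E F U V \<and>
      (\<forall>x\<in>E. \<forall>y\<in>E. U (x + y) = U x + U y) \<and> (\<forall>c. \<forall>x\<in>E. U (c *\<^sub>K x) = c *\<^sub>K U x))"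

definition not_bounded_below_on_copies ::
    "('b, 'k::real_normed_field) linfc set \<Rightarrow> (('a, 'k) linfc \<Rightarrow>\<^sub>L ('a, 'k) linfc) set" ("\<S>")
  where "\<S> E =
    {T :: ('a, 'k) linfc \<Rightarrow>\<^sub>L ('a, 'k) linfc. T \<in> operators \<and>
      \<not> (\<exists>E\<^sub>0 c. K_subspace E\<^sub>0 \<and> isomorphic_spaces E\<^sub>0 E \<and> c > 0 \<and>
            (\<forall>x\<in>E\<^sub>0. norm (T x) \<ge> c * norm x))}"

unbundle cardinal_syntax

end

theory Submission
  imports Defs "HOL-Library.Countable_Set_Type"
begin

text \<open>
  Write \<open>X = \<ell>\<^sub>\<infinity>\<^sup>c(\<lambda>)\<close>, and for a set \<open>A\<close> of coordinates let \<open>proj A\<close> be the restriction to \<open>A\<close>.  Given a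
  closed ideal \<open>I\<close>, take an infinite \<open>A\<close> of least cardinality with \<open>proj A \<notin> I\<close> and let \<open>\<kappa> = |A|\<close>.  If
  there is none, then \<open>I\<close> contains the identity; in that case \<open>\<kappa> = \<lambda>\<^sup>+\<close> works, because no copy of
  \<open>\<ell>\<^sub>\<infinity>\<^sup>c(\<lambda>\<^sup>+)\<close> fits into \<open>X\<close> (\<open>no_larger_copy\<close>).

  The tool for moving between operators and coordinates is \<open>diagonal_dominance\<close>.  Suppose that an
  operator \<open>S\<close> keeps the unit vectors \<open>e\<^sub>i\<close>, for \<open>i\<close> in an infinite set, away from \<open>0\<close>.  Choose for each
  \<open>i\<close> a coordinate at which \<open>S e\<^sub>i\<close> is large.  The functionals read off there have total variations that
  behave like finitely additive measures of uniformly bounded mass.  Rosenthal's disjointification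
  argument, which works at every infinite cardinality, passes to equally many indices such that the
  matrix of \<open>S\<close> is almost diagonal with entries bounded away from \<open>0\<close>.

  \<^item> \<open>I \<subseteq> \<S>(\<kappa>)\<close>: if \<open>T \<in> I\<close> were bounded below on a copy of \<open>\<ell>\<^sub>\<infinity>\<^sup>c(\<kappa>)\<close>, then by diagonal dominance \<open>proj A\<close>
    would be a norm limit of operators \<open>V T U\<close>, hence in the closed ideal \<open>I\<close>
    (\<open>projection_in_ideal\<close>).  Only approximation is used, so no inverse is ever formed.

  \<^item> \<open>\<S>(\<kappa>) \<subseteq> I\<close> for uncountable \<open>\<kappa>\<close>: diagonal dominance also shows that an operator fixes a copy of
    \<open>\<ell>\<^sub>\<infinity>\<^sup>c(\<kappa>)\<close> as soon as it keeps \<open>\<kappa>\<close> many disjointly supported vectors of the unit ball away from \<open>0\<close>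
    (\<open>disjoint_family_fixes_copy\<close>).  So for \<open>T \<in> \<S>(\<kappa>)\<close> a maximal disjoint family with \<open>\<parallel>T x\<parallel> > \<epsilon>\<close> has fewer
    than \<open>\<kappa>\<close> members.  The union \<open>C\<close> of its countable supports is smaller than \<open>\<kappa>\<close>, and maximality gives
    \<open>\<parallel>T - T proj C\<parallel> \<le> \<epsilon>\<close>.  By minimality of \<open>\<kappa>\<close> the operator \<open>T proj C\<close> is in \<open>I\<close>.

  \<^item> \<open>\<S>(\<kappa>) \<subseteq> I\<close> for countable \<open>\<kappa>\<close>: such a \<open>T\<close> is weakly compact.  Its coordinate functionals are uniformly
    exhaustive, hence uniformly absolutely continuous with respect to countably many of them
    (\<open>uniform_control\<close>).  Adding up the quadratic forms \<open>x \<mapsto> \<integral>|x|\<^sup>2 d|\<phi>|\<close> of these functionals gives a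
    form \<open>q\<close> that satisfies the parallelogram law and controls \<open>T\<close>: on the unit ball \<open>T x\<close> is small when
    \<open>q x\<close> is.  A point of the weak* closure of \<open>T\<close>(ball) is then realised by a vector, namely the limit
    of \<open>T x\<^sub>n\<close> for near-minimisers \<open>x\<^sub>n\<close> of \<open>q\<close> over shrinking convex sets, as for projections onto
    convex sets in Hilbert space (\<open>weak_limit_represented\<close>).
\<close>

section \<open>Weighted composition operators\<close>

definition K_linear :: "(('b, 'k::real_normed_field) linfc \<Rightarrow>\<^sub>L ('a, 'k) linfc) \<Rightarrow> bool"
  where "K_linear S \<longleftrightarrow> (\<forall>c x. S (c *\<^sub>K x) = c *\<^sub>K S x)"

lemma K_linear_iff_operators: "K_linear T \<longleftrightarrow> T \<in> operators"
  by (simp add: K_linear_def operators_def)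

lemma K_linear_compose: "K_linear S \<Longrightarrow> K_linear T \<Longrightarrow> K_linear (S o\<^sub>L T)"
  by (simp add: K_linear_def)

lemma scaleR_eq_scaleK: "r *\<^sub>R x = of_real r *\<^sub>K x" for x :: "('a, 'k::real_normed_field) linfc"
  by (rule linfc_eqI) (simp add: scaleK.rep_eq scaleR_conv_of_real)

definition unit_vec :: "'b \<Rightarrow> ('b, 'k::real_normed_field) linfc"
  where "unit_vec i = Abs_linfc (\<lambda>\<alpha>. if \<alpha> = i then 1 else 0)"

lemma coord_unit_vec [simp]:
  "coord (unit_vec i :: ('b, 'k::real_normed_field) linfc) \<alpha> = (if \<alpha> = i then 1 else 0)"
proof -
  have "bounded (range (\<lambda>\<alpha>. if \<alpha> = i then 1 else 0 :: 'k))"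
    by (rule boundedI[where B = 1]) auto
  then show ?thesis
    unfolding unit_vec_def by (subst Abs_linfc_inverse) auto
qed

lemma norm_unit_vec [simp]: "norm (unit_vec i :: ('b, 'k::real_normed_field) linfc) = 1"
proof (rule antisym)
  show "norm (unit_vec i :: ('b, 'k) linfc) \<le> 1"
    by (rule norm_linfc_le) simp
  show "1 \<le> norm (unit_vec i :: ('b, 'k) linfc)"
    using norm_coord_le[of "unit_vec i :: ('b, 'k) linfc" i] by simp
qed

text \<open>
  Such a pair \<open>(g, w)\<close> makes \<open>z \<mapsto> (\<lambda>\<alpha>. w \<alpha> * z (g \<alpha>))\<close> preserve both boundedness and
  countability of supports.  Coordinate projections, changes of the index set and the map that sends
  the unit vectors to a given disjointly supported bounded family all have this form.
\<close>

definition admissible :: "('a \<Rightarrow> 'b) \<Rightarrow> ('a \<Rightarrow> 'k::real_normed_field) \<Rightarrow> bool"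
  where "admissible g w \<longleftrightarrow> bounded (range w) \<and> (\<forall>i. countable {\<alpha>. g \<alpha> = i \<and> w \<alpha> \<noteq> 0})"

definition wcomp ::
    "('a \<Rightarrow> 'b) \<Rightarrow> ('a \<Rightarrow> 'k::real_normed_field) \<Rightarrow> ('b, 'k) linfc \<Rightarrow>\<^sub>L ('a, 'k) linfc"
  where "wcomp g w = Blinfun (\<lambda>z. Abs_linfc (\<lambda>\<alpha>. w \<alpha> * coord z (g \<alpha>)))"

lemma wcomp_apply:
  fixes w :: "'a \<Rightarrow> 'k::real_normed_field" and z :: "('b, 'k) linfc"
  assumes "admissible g w"
  shows "coord (wcomp g w z) \<alpha> = w \<alpha> * coord z (g \<alpha>)"
proof -
  obtain B where B: "\<And>\<alpha>. norm (w \<alpha>) \<le> B"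
    using assms by (auto simp: admissible_def bounded_iff)
  have B0: "0 \<le> B" using B[of undefined] norm_ge_zero order_trans by blast
  have Bz: "norm (w \<alpha> * coord z (g \<alpha>)) \<le> B * norm z" for z :: "('b, 'k) linfc" and \<alpha>
    by (simp add: norm_mult mult_mono B B0 norm_coord_le)
  have "countable {\<alpha>. w \<alpha> * coord z (g \<alpha>) \<noteq> 0}" for z :: "('b, 'k) linfc"
  proof (rule countable_subset)
    show "{\<alpha>. w \<alpha> * coord z (g \<alpha>) \<noteq> 0}
        \<subseteq> (\<Union>i\<in>{i. coord z i \<noteq> 0}. {\<alpha>. g \<alpha> = i \<and> w \<alpha> \<noteq> 0})"
      by auto
    show "countable (\<Union>i\<in>{i. coord z i \<noteq> 0}. {\<alpha>. g \<alpha> = i \<and> w \<alpha> \<noteq> 0})"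
      using coord[of z] assms by (auto simp: admissible_def)
  qed
  then have c: "coord (Abs_linfc (\<lambda>\<alpha>. w \<alpha> * coord z (g \<alpha>))) = (\<lambda>\<alpha>. w \<alpha> * coord z (g \<alpha>))"
    for z :: "('b, 'k) linfc"
    using Bz[of _ z] by (subst Abs_linfc_inverse) (auto intro: boundedI)
  have "bounded_linear (\<lambda>z::('b, 'k) linfc. Abs_linfc (\<lambda>\<alpha>. w \<alpha> * coord z (g \<alpha>)))"
  proof (rule bounded_linear_intro[where K = B])
    fix z :: "('b, 'k) linfc"
    show "norm (Abs_linfc (\<lambda>\<alpha>. w \<alpha> * coord z (g \<alpha>))) \<le> norm z * B"
      by (rule norm_linfc_le) (use Bz[of _ z] in \<open>simp add: c mult.commute\<close>)
  qed (rule linfc_eqI, simp only: c, simp add: c algebra_simps)+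
  then show ?thesis
    unfolding wcomp_def by (simp add: bounded_linear_Blinfun_apply c)
qed

lemma norm_wcomp_le:
  assumes "admissible g w" "\<And>\<alpha>. norm (w \<alpha>) \<le> B"
  shows "norm (wcomp g w z) \<le> B * norm z"
proof (rule norm_linfc_le)
  fix \<alpha>
  have "0 \<le> B" using assms(2)[of \<alpha>] norm_ge_zero order_trans by blast
  then show "norm (coord (wcomp g w z) \<alpha>) \<le> B * norm z"
    by (simp add: wcomp_apply[OF assms(1)] norm_mult mult_mono assms(2) norm_coord_le)
qed

lemma K_linear_wcomp: "admissible g w \<Longrightarrow> K_linear (wcomp g w)"
  by (auto simp: K_linear_def wcomp_apply scaleK.rep_eq intro!: linfc_eqI)

lemma admissible_inj_on:
  assumes "inj_on g A" "\<And>\<alpha>. norm (w \<alpha>) \<le> B" "\<And>\<alpha>. \<alpha> \<notin> A \<Longrightarrow> w \<alpha> = 0"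
  shows "admissible g w"
  unfolding admissible_def
proof (intro conjI allI)
  show "bounded (range w)" using assms(2) by (auto intro: boundedI)
  fix i
  have "{\<alpha>. g \<alpha> = i \<and> w \<alpha> \<noteq> 0} \<subseteq> {inv_into A g i}"
    using assms(1,3) by (force simp: inv_into_f_f)
  then show "countable {\<alpha>. g \<alpha> = i \<and> w \<alpha> \<noteq> 0}"
    by (rule countable_subset) simp
qed

definition proj :: "'a set \<Rightarrow> ('a, 'k::real_normed_field) linfc \<Rightarrow>\<^sub>L ('a, 'k) linfc"
  where "proj A = wcomp id (\<lambda>\<alpha>. if \<alpha> \<in> A then 1 else 0)"

lemma admissible_proj:
  "admissible id (\<lambda>\<alpha>. if \<alpha> \<in> A then 1 else 0 :: 'k::real_normed_field)"
  by (rule admissible_inj_on[where A = A and B = 1]) auto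

lemma coord_proj [simp]: "coord (proj A z) \<alpha> = (if \<alpha> \<in> A then coord z \<alpha> else 0)"
  by (simp add: proj_def wcomp_apply[OF admissible_proj])

lemma norm_proj_le: "norm (proj A z) \<le> norm z"
  using norm_wcomp_le[OF admissible_proj[of A], of 1 z] by (simp add: proj_def)

lemma K_linear_proj: "K_linear (proj A)"
  by (simp add: proj_def K_linear_wcomp admissible_proj)

text \<open>
  For disjointly supported \<open>x i\<close> this is the operator with \<open>unit_vec i \<mapsto> x i\<close>.  At each coordinate at
  most one \<open>x i\<close> is nonzero, so no convergence is involved.
\<close>

definition block_op ::
    "('b \<Rightarrow> ('a, 'k::real_normed_field) linfc) \<Rightarrow> ('b, 'k) linfc \<Rightarrow>\<^sub>L ('a, 'k) linfc"
  where "block_op x =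
    wcomp (\<lambda>\<alpha>. SOME i. coord (x i) \<alpha> \<noteq> 0) (\<lambda>\<alpha>. coord (x (SOME i. coord (x i) \<alpha> \<noteq> 0)) \<alpha>)"

definition disjoint_supports :: "('b \<Rightarrow> ('a, 'k::real_normed_field) linfc) \<Rightarrow> bool"
  where "disjoint_supports x \<longleftrightarrow>
    (\<forall>i j \<alpha>. coord (x i) \<alpha> \<noteq> 0 \<longrightarrow> coord (x j) \<alpha> \<noteq> 0 \<longrightarrow> i = j)"

lemma admissible_block:
  fixes x :: "'b \<Rightarrow> ('a, 'k::real_normed_field) linfc"
  assumes "\<And>i. norm (x i) \<le> B"
  shows "admissible (\<lambda>\<alpha>. SOME i. coord (x i) \<alpha> \<noteq> 0)
    (\<lambda>\<alpha>. coord (x (SOME i. coord (x i) \<alpha> \<noteq> 0)) \<alpha>)"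
  unfolding admissible_def
proof (intro conjI allI)
  show "bounded (range (\<lambda>\<alpha>. coord (x (SOME i. coord (x i) \<alpha> \<noteq> 0)) \<alpha>))"
    using order_trans[OF norm_coord_le assms] by (auto intro: boundedI)
  fix i
  show "countable {\<alpha>. (SOME i. coord (x i) \<alpha> \<noteq> 0) = i \<and>
      coord (x (SOME i. coord (x i) \<alpha> \<noteq> 0)) \<alpha> \<noteq> 0}"
    by (rule countable_subset[of _ "{\<alpha>. coord (x i) \<alpha> \<noteq> 0}"]) (use coord[of "x i"] in auto)
qed

lemma K_linear_block: "(\<And>i. norm (x i) \<le> B) \<Longrightarrow> K_linear (block_op x)"
  unfolding block_op_def by (intro K_linear_wcomp admissible_block)

lemma norm_block_le:
  assumes "\<And>i. norm (x i) \<le> B"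
  shows "norm (block_op x z) \<le> B * norm z"
  unfolding block_op_def
  by (rule norm_wcomp_le[OF admissible_block]) (rule assms order_trans[OF norm_coord_le assms])+

lemma coord_block:
  assumes "disjoint_supports x" "\<And>i. norm (x i) \<le> B" "coord (x i) \<alpha> \<noteq> 0"
  shows "coord (block_op x z) \<alpha> = coord z i * coord (x i) \<alpha>"
proof -
  have "(SOME i. coord (x i) \<alpha> \<noteq> 0) = i"
    using someI[of "\<lambda>i. coord (x i) \<alpha> \<noteq> 0", OF assms(3)] assms(1,3)
    unfolding disjoint_supports_def by blast
  then show ?thesis
    by (simp add: block_op_def wcomp_apply[OF admissible_block[where x = x and B = B, OF assms(2)]])
qed

lemma coord_block_eq_0:
  assumes "\<And>i. norm (x i) \<le> B" "\<And>i. coord (x i) \<alpha> = 0"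
  shows "coord (block_op x z) \<alpha> = 0"
  by (simp add: block_op_def wcomp_apply[OF admissible_block[where x = x and B = B, OF assms(1)]] assms(2))

lemma block_op_unit_vec:
  assumes "disjoint_supports x" "\<And>i. norm (x i) \<le> B"
  shows "block_op x (unit_vec i) = x i"
proof (rule linfc_eqI)
  fix \<alpha>
  show "coord (block_op x (unit_vec i)) \<alpha> = coord (x i) \<alpha>"
  proof (cases "\<exists>j. coord (x j) \<alpha> \<noteq> 0")
    case True
    then obtain j where j: "coord (x j) \<alpha> \<noteq> 0" by blast
    then have "j = i" if "coord (x i) \<alpha> \<noteq> 0"
      using assms(1) that unfolding disjoint_supports_def by blast
    then show ?thesis
      using coord_block[OF assms j, of "unit_vec i"] by auto
  qed (use coord_block_eq_0[where x = x and B = B, OF assms(2)] in auto)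
qed

section \<open>The total variation of a functional\<close>

definition variation :: "(('b, 'k::real_normed_field) linfc \<Rightarrow>\<^sub>L 'k) \<Rightarrow> ('b \<Rightarrow> real) \<Rightarrow> real"
  where "variation \<phi> f = (SUP g\<in>{g. \<forall>\<alpha>. norm (coord g \<alpha>) \<le> f \<alpha>}. norm (\<phi> g))"

lemma variation_upper:
  fixes \<phi> :: "('b, 'k::real_normed_field) linfc \<Rightarrow>\<^sub>L 'k"
  assumes "\<And>\<alpha>. f \<alpha> \<le> B" "\<And>\<alpha>. norm (coord g \<alpha>) \<le> f \<alpha>"
  shows "norm (\<phi> g) \<le> variation \<phi> f"
  unfolding variation_def
proof (rule cSUP_upper)
  show "bdd_above ((\<lambda>g. norm (\<phi> g)) ` {g. \<forall>\<alpha>. norm (coord g \<alpha>) \<le> f \<alpha>})"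
  proof (rule bdd_aboveI2)
    fix g :: "('b, 'k) linfc"
    assume "g \<in> {g. \<forall>\<alpha>. norm (coord g \<alpha>) \<le> f \<alpha>}"
    then have "norm g \<le> B"
      using assms(1) by (intro norm_linfc_le) (auto intro: order_trans)
    then show "norm (\<phi> g) \<le> norm \<phi> * B"
      using norm_blinfun[of \<phi> g] mult_left_mono[OF \<open>norm g \<le> B\<close>, of "norm \<phi>"] by simp
  qed
qed (use assms in auto)

lemma variation_least:
  fixes \<phi> :: "('b, 'k::real_normed_field) linfc \<Rightarrow>\<^sub>L 'k"
  assumes "\<And>\<alpha>. 0 \<le> f \<alpha>" "\<And>g. (\<And>\<alpha>. norm (coord g \<alpha>) \<le> f \<alpha>) \<Longrightarrow> norm (\<phi> g) \<le> c"
  shows "variation \<phi> f \<le> c"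
  unfolding variation_def
proof (rule cSUP_least)
  show "{g::('b, 'k) linfc. \<forall>\<alpha>. norm (coord g \<alpha>) \<le> f \<alpha>} \<noteq> {}"
    using assms(1) by (auto intro!: exI[of _ 0])
qed (use assms(2) in auto)

lemma variation_nonneg:
  fixes \<phi> :: "('b, 'k::real_normed_field) linfc \<Rightarrow>\<^sub>L 'k"
  assumes "\<And>\<alpha>. 0 \<le> f \<alpha>" "\<And>\<alpha>. f \<alpha> \<le> B"
  shows "0 \<le> variation \<phi> f"
  using variation_upper[where f = f and g = 0 and \<phi> = \<phi>, OF assms(2)] assms(1) by simp

lemma variation_le:
  fixes \<phi> :: "('b, 'k::real_normed_field) linfc \<Rightarrow>\<^sub>L 'k"
  assumes "\<And>\<alpha>. 0 \<le> f \<alpha>" "\<And>\<alpha>. f \<alpha> \<le> B"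
  shows "variation \<phi> f \<le> norm \<phi> * B"
proof (rule variation_least[OF assms(1)])
  fix g :: "('b, 'k) linfc"
  assume "\<And>\<alpha>. norm (coord g \<alpha>) \<le> f \<alpha>"
  then have "norm g \<le> B"
    using assms by (intro norm_linfc_le) (auto intro: order_trans)
  then show "norm (\<phi> g) \<le> norm \<phi> * B"
    using norm_blinfun[of \<phi> g] mult_left_mono[OF \<open>norm g \<le> B\<close>, of "norm \<phi>"] by simp
qed

lemma variation_mono:
  fixes \<phi> :: "('b, 'k::real_normed_field) linfc \<Rightarrow>\<^sub>L 'k"
  assumes "\<And>\<alpha>. 0 \<le> f \<alpha>" "\<And>\<alpha>. f \<alpha> \<le> g \<alpha>" "\<And>\<alpha>. g \<alpha> \<le> B"
  shows "variation \<phi> f \<le> variation \<phi> g"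
  by (rule variation_least[OF assms(1)], rule variation_upper[OF assms(3)])
     (use assms(2) order_trans in blast)

lemma variation_superadditive:
  fixes \<phi> :: "('b, 'k::real_normed_field) linfc \<Rightarrow>\<^sub>L 'k"
  assumes \<phi>: "\<phi> \<in> functionals"
    and f: "\<And>\<alpha>. 0 \<le> f \<alpha>" "\<And>\<alpha>. f \<alpha> \<le> B" and g: "\<And>\<alpha>. 0 \<le> g \<alpha>" "\<And>\<alpha>. g \<alpha> \<le> C"
  shows "variation \<phi> f + variation \<phi> g \<le> variation \<phi> (\<lambda>\<alpha>. f \<alpha> + g \<alpha>)"
proof -
  have le: "norm (\<phi> u) + norm (\<phi> v) \<le> variation \<phi> (\<lambda>\<alpha>. f \<alpha> + g \<alpha>)"
    if u: "\<And>\<alpha>. norm (coord u \<alpha>) \<le> f \<alpha>" and v: "\<And>\<alpha>. norm (coord v \<alpha>) \<le> g \<alpha>" for u v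
  proof -
    \<comment> \<open>Rotating by unimodular scalars makes both values real and nonnegative.\<close>
    have rot: "\<exists>c. norm c = 1 \<and> c * a = of_real (norm a)" for a :: 'k
    proof (cases "a = 0")
      case False
      then show ?thesis
        by (intro exI[of _ "of_real (norm a) / a"]) (simp add: norm_divide)
    qed (auto intro: exI[of _ 1])
    obtain c where c: "norm c = 1" "c * \<phi> u = of_real (norm (\<phi> u))" using rot by blast
    obtain d where d: "norm d = 1" "d * \<phi> v = of_real (norm (\<phi> v))" using rot by blast
    have "\<phi> (c *\<^sub>K u + d *\<^sub>K v) = of_real (norm (\<phi> u) + norm (\<phi> v))"
      using \<phi> c d by (simp add: functionals_def blinfun.add_right)
    then have "norm (\<phi> u) + norm (\<phi> v) = norm (\<phi> (c *\<^sub>K u + d *\<^sub>K v))"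
      by (simp del: of_real_add)
    also have "\<dots> \<le> variation \<phi> (\<lambda>\<alpha>. f \<alpha> + g \<alpha>)"
    proof (rule variation_upper)
      show "f \<alpha> + g \<alpha> \<le> B + C" for \<alpha> using f(2) g(2) by (simp add: add_mono)
      show "norm (coord (c *\<^sub>K u + d *\<^sub>K v) \<alpha>) \<le> f \<alpha> + g \<alpha>" for \<alpha>
        using norm_triangle_mono[of "c * coord u \<alpha>" "f \<alpha>" "d * coord v \<alpha>" "g \<alpha>"] u v c d
        by (simp add: scaleK.rep_eq norm_mult)
    qed
    finally show ?thesis .
  qed
  have "variation \<phi> f \<le> variation \<phi> (\<lambda>\<alpha>. f \<alpha> + g \<alpha>) - norm (\<phi> v)"
    if "\<And>\<alpha>. norm (coord v \<alpha>) \<le> g \<alpha>" for v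
    by (rule variation_least[OF f(1)]) (use le[OF _ that] in \<open>auto simp: le_diff_eq\<close>)
  then have "variation \<phi> g \<le> variation \<phi> (\<lambda>\<alpha>. f \<alpha> + g \<alpha>) - variation \<phi> f"
    by (intro variation_least[OF g(1)]) (auto simp: le_diff_eq add.commute)
  then show ?thesis by simp
qed

text \<open>
  For the upper bound, a vector dominated by \<open>f + g\<close> splits pointwise in the ratio \<open>f : g\<close>.  Additivity
  lets \<open>variation \<phi>\<close> serve as the integral against the finitely additive measure \<open>|\<phi>|\<close>.
\<close>

lemma variation_add:
  fixes \<phi> :: "('b, 'k::real_normed_field) linfc \<Rightarrow>\<^sub>L 'k"
  assumes \<phi>: "\<phi> \<in> functionals"
    and f: "\<And>\<alpha>. 0 \<le> f \<alpha>" "\<And>\<alpha>. f \<alpha> \<le> B" and g: "\<And>\<alpha>. 0 \<le> g \<alpha>" "\<And>\<alpha>. g \<alpha> \<le> C"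
  shows "variation \<phi> (\<lambda>\<alpha>. f \<alpha> + g \<alpha>) = variation \<phi> f + variation \<phi> g"
proof (rule antisym)
  show "variation \<phi> (\<lambda>\<alpha>. f \<alpha> + g \<alpha>) \<le> variation \<phi> f + variation \<phi> g"
  proof (rule variation_least)
    show "0 \<le> f \<alpha> + g \<alpha>" for \<alpha> using f(1) g(1) by simp
    fix u :: "('b, 'k) linfc"
    assume u: "\<And>\<alpha>. norm (coord u \<alpha>) \<le> f \<alpha> + g \<alpha>"
    \<comment> \<open>The weight that splits \<open>u\<close> in the ratio \<open>f : g\<close>; where \<open>f + g = 0\<close> it is \<open>0\<close>, as is \<open>u\<close>.\<close>
    define w :: "'b \<Rightarrow> 'k" where "w \<alpha> = of_real (f \<alpha> / (f \<alpha> + g \<alpha>))" for \<alpha>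
    have w1: "norm (w \<alpha>) \<le> 1" for \<alpha>
      unfolding w_def norm_of_real using f(1)[of \<alpha>] g(1)[of \<alpha>] by (auto simp: divide_le_eq_1)
    have adm: "admissible id w"
      by (rule admissible_inj_on[where A = UNIV and B = 1]) (use w1 in auto)
    define v where "v = wcomp id w u"
    have v: "coord v \<alpha> = w \<alpha> * coord u \<alpha>" for \<alpha>
      by (simp add: v_def wcomp_apply[OF adm])
    have vf: "norm (coord v \<alpha>) \<le> f \<alpha>" and vg: "norm (coord (u - v) \<alpha>) \<le> g \<alpha>" for \<alpha>
    proof -
      have "norm (coord v \<alpha>) \<le> f \<alpha> \<and> norm (coord (u - v) \<alpha>) \<le> g \<alpha>"
      proof (cases "f \<alpha> + g \<alpha> = 0")
        case True
        then have "coord u \<alpha> = 0" using u[of \<alpha>] by simp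
        then show ?thesis using f(1)[of \<alpha>] g(1)[of \<alpha>] by (simp add: v)
      next
        case False
        then have pos: "f \<alpha> + g \<alpha> > 0" using f(1)[of \<alpha>] g(1)[of \<alpha>] by linarith
        have "1 - f \<alpha> / (f \<alpha> + g \<alpha>) = g \<alpha> / (f \<alpha> + g \<alpha>)"
          using pos by (simp add: field_simps)
        then have "1 - w \<alpha> = of_real (g \<alpha> / (f \<alpha> + g \<alpha>))"
          unfolding w_def by (metis of_real_1 of_real_diff)
        moreover have "coord (u - v) \<alpha> = (1 - w \<alpha>) * coord u \<alpha>"
          by (simp add: v algebra_simps)
        ultimately have "norm (coord (u - v) \<alpha>) = g \<alpha> / (f \<alpha> + g \<alpha>) * norm (coord u \<alpha>)"
          using g(1)[of \<alpha>] pos by (simp only: norm_mult norm_of_real) simp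
        moreover have "norm (coord v \<alpha>) = f \<alpha> / (f \<alpha> + g \<alpha>) * norm (coord u \<alpha>)"
          unfolding v w_def norm_mult norm_of_real using f(1)[of \<alpha>] pos by simp
        ultimately show ?thesis
          using mult_left_mono[OF u[of \<alpha>], of "f \<alpha> / (f \<alpha> + g \<alpha>)"]
            mult_left_mono[OF u[of \<alpha>], of "g \<alpha> / (f \<alpha> + g \<alpha>)"] f(1)[of \<alpha>] g(1)[of \<alpha>] pos
          by simp
      qed
      then show "norm (coord v \<alpha>) \<le> f \<alpha>" "norm (coord (u - v) \<alpha>) \<le> g \<alpha>" by auto
    qed
    have "\<phi> u = \<phi> v + \<phi> (u - v)"
      by (simp flip: blinfun.add_right)
    then have "norm (\<phi> u) \<le> norm (\<phi> v) + norm (\<phi> (u - v))"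
      by (simp add: norm_triangle_ineq)
    also have "\<dots> \<le> variation \<phi> f + variation \<phi> g"
      by (intro add_mono variation_upper[OF f(2)] variation_upper[OF g(2)] vf vg)
    finally show "norm (\<phi> u) \<le> variation \<phi> f + variation \<phi> g" .
  qed
qed (rule variation_superadditive[OF assms])

lemma variation_scale_ge:
  fixes \<phi> :: "('b, 'k::real_normed_field) linfc \<Rightarrow>\<^sub>L 'k"
  assumes f: "\<And>\<alpha>. 0 \<le> f \<alpha>" "\<And>\<alpha>. f \<alpha> \<le> B" and c: "c > 0"
  shows "c * variation \<phi> f \<le> variation \<phi> (\<lambda>\<alpha>. c * f \<alpha>)"
proof -
  have "variation \<phi> f \<le> variation \<phi> (\<lambda>\<alpha>. c * f \<alpha>) / c"
  proof (rule variation_least[OF f(1)])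
    fix g :: "('b, 'k) linfc"
    assume g: "\<And>\<alpha>. norm (coord g \<alpha>) \<le> f \<alpha>"
    have "norm (\<phi> (c *\<^sub>R g)) \<le> variation \<phi> (\<lambda>\<alpha>. c * f \<alpha>)"
      by (rule variation_upper[where B = "c * B"]) (use g f c in auto)
    then show "norm (\<phi> g) \<le> variation \<phi> (\<lambda>\<alpha>. c * f \<alpha>) / c"
      using c by (simp add: blinfun.scaleR_right field_simps)
  qed
  then show ?thesis using c by (simp add: field_simps)
qed

definition mass :: "(('b, 'k::real_normed_field) linfc \<Rightarrow>\<^sub>L 'k) \<Rightarrow> 'b set \<Rightarrow> real"
  where "mass \<phi> E = variation \<phi> (indicat_real E)"

lemma mass_nonneg: "0 \<le> mass \<phi> E"
  unfolding mass_def by (rule variation_nonneg[where B = 1]) auto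

lemma mass_le_norm: "mass \<phi> E \<le> norm \<phi>"
  unfolding mass_def using variation_le[of "indicat_real E" 1 \<phi>] by simp

lemma mass_Un:
  fixes \<phi> :: "('b, 'k::real_normed_field) linfc \<Rightarrow>\<^sub>L 'k"
  assumes "\<phi> \<in> functionals" "E \<inter> F = {}"
  shows "mass \<phi> (E \<union> F) = mass \<phi> E + mass \<phi> F"
proof -
  have "indicat_real (E \<union> F) = (\<lambda>\<alpha>. indicat_real E \<alpha> + indicat_real F \<alpha>)"
    using assms(2) by (auto simp: fun_eq_iff indicator_def)
  then show ?thesis
    unfolding mass_def
    using variation_add[OF assms(1), of "indicat_real E" 1 "indicat_real F" 1] by simp
qed

lemma norm_le_mass:
  fixes \<phi> :: "('b, 'k::real_normed_field) linfc \<Rightarrow>\<^sub>L 'k"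
  assumes supp: "\<And>\<alpha>. \<alpha> \<notin> E \<Longrightarrow> coord x \<alpha> = 0"
  shows "norm (\<phi> x) \<le> mass \<phi> E * norm x"
proof (cases "norm x = 0")
  case False
  then have pos: "norm x > 0" by simp
  have "norm (\<phi> (x /\<^sub>R norm x)) \<le> mass \<phi> E"
    unfolding mass_def
  proof (rule variation_upper[where B = 1])
    fix \<alpha>
    show "norm (coord (x /\<^sub>R norm x) \<alpha>) \<le> indicat_real E \<alpha>"
      using supp[of \<alpha>] norm_coord_le[of x \<alpha>] pos
      by (cases "\<alpha> \<in> E") (auto simp: field_simps)
  qed auto
  then show ?thesis
    using pos by (simp add: blinfun.scaleR_right field_simps)
qed simp

lemma mass_witness:
  fixes \<phi> :: "('b, 'k::real_normed_field) linfc \<Rightarrow>\<^sub>L 'k"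
  assumes "mass \<phi> E > c"
  obtains x where "\<And>\<alpha>. \<alpha> \<notin> E \<Longrightarrow> coord x \<alpha> = 0" "norm x \<le> 1" "norm (\<phi> x) > c"
proof -
  obtain x where x: "\<And>\<alpha>. norm (coord x \<alpha>) \<le> indicat_real E \<alpha>" "norm (\<phi> x) > c"
    using variation_least[of "indicat_real E" \<phi> c] assms
    unfolding mass_def by (metis indicator_pos_le not_le)
  show ?thesis
  proof (rule that)
    show "coord x \<alpha> = 0" if "\<alpha> \<notin> E" for \<alpha>
      using x(1)[of \<alpha>] that by simp
    show "norm x \<le> 1"
      by (rule norm_linfc_le) (rule order_trans[OF x(1)], simp)
  qed (rule x(2))
qed

definition component :: "(('b, 'k::real_normed_field) linfc \<Rightarrow>\<^sub>L ('a, 'k) linfc) \<Rightarrow> 'a \<Rightarrow>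
    ('b, 'k) linfc \<Rightarrow>\<^sub>L 'k"
  where "component S \<gamma> = Blinfun (\<lambda>x. coord (S x) \<gamma>)"

lemma component_apply: "component S \<gamma> x = coord (S x) \<gamma>"
proof -
  have "bounded_linear (\<lambda>x. coord (S x) \<gamma>)"
  proof (rule bounded_linear_intro[where K = "norm S"])
    show "norm (coord (S x) \<gamma>) \<le> norm x * norm S" for x
      using norm_coord_le[of "S x" \<gamma>] norm_blinfun[of S x] by (simp add: mult.commute)
  qed (simp_all add: blinfun.add_right blinfun.scaleR_right)
  then show ?thesis by (simp add: component_def bounded_linear_Blinfun_apply)
qed

lemma norm_component_le: "norm (component S \<gamma>) \<le> norm S"
proof (rule norm_blinfun_bound)
  show "norm (component S \<gamma> x) \<le> norm S * norm x" for x
    unfolding component_apply using norm_coord_le[of "S x" \<gamma>] norm_blinfun[of S x] by simp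
qed simp

lemma component_functional: "K_linear S \<Longrightarrow> component S \<gamma> \<in> functionals"
  by (simp add: functionals_def component_apply K_linear_def scaleK.rep_eq)

section \<open>Disjointification and diagonal dominance\<close>

text \<open>
  Cut \<open>A\<close> into \<open>|A|\<close> pieces of size \<open>|A|\<close>.  Either some piece is as desired, or each piece \<open>B\<close> contains an
  index \<open>i\<close> with \<open>m i (B - {i}) > \<epsilon>\<close>.  The transversal formed by these indices meets each piece once, so
  superadditivity lowers the bound on \<open>m i (A - {i})\<close> by \<open>\<epsilon>\<close> along it.  As the masses are bounded, the
  second case occurs finitely often.
\<close>

lemma rosenthal_disjointification:
  fixes m :: "'i \<Rightarrow> 'i set \<Rightarrow> real"
  assumes nonneg: "\<And>i B. 0 \<le> m i B"
    and super: "\<And>i B C. B \<inter> C = {} \<Longrightarrow> m i B + m i C \<le> m i (B \<union> C)"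
    and bound: "\<And>i B. m i B \<le> M"
    and A: "infinite A" and \<epsilon>: "\<epsilon> > 0"
  shows "\<exists>J\<subseteq>A. |J| =o |A| \<and> (\<forall>i\<in>J. m i (J - {i}) \<le> \<epsilon>)"
proof -
  have "\<exists>J\<subseteq>A. |J| =o |A| \<and> (\<forall>i\<in>J. m i (J - {i}) \<le> \<epsilon>)"
    if "infinite A" "\<And>i. i \<in> A \<Longrightarrow> m i (A - {i}) \<le> real n * \<epsilon>" for n A
    using that
  proof (induction n arbitrary: A)
    case 0
    then show ?case using \<epsilon> by (intro exI[of _ A]) (fastforce intro: card_of_refl)
  next
    case (Suc n)
    have "|A \<times> A| =o |A|" by (rule card_of_Times_same_infinite[OF Suc.prems(1)])
    then obtain f where f: "bij_betw f (A \<times> A) A"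
      using card_of_ordIso by blast
    define B where "B p = f ` ({p} \<times> A)" for p
    have inj: "inj_on f (A \<times> A)" and fA: "f ` (A \<times> A) = A"
      using f by (auto simp: bij_betw_def)
    have BA: "B p \<subseteq> A" if "p \<in> A" for p
      using that fA unfolding B_def by blast
    have cardB: "|B p| =o |A|" if "p \<in> A" for p
    proof -
      have "bij_betw (\<lambda>a. f (p, a)) A (B p)"
        unfolding B_def using inj that
        by (intro bij_betw_imageI) (auto simp: inj_on_def image_def)
      then show ?thesis using card_of_ordIso ordIso_symmetric by blast
    qed
    have disj: "B p \<inter> B q = {}" if "p \<in> A" "q \<in> A" "p \<noteq> q" for p q
      using that by (auto simp: B_def dest: inj_onD[OF inj])
    show ?case
    proof (cases "\<exists>p\<in>A. \<forall>i\<in>B p. m i (B p - {i}) \<le> \<epsilon>")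
      case True
      then show ?thesis using BA cardB by blast
    next
      case False
      then have "\<forall>p\<in>A. \<exists>i. i \<in> B p \<and> \<epsilon> < m i (B p - {i})"
        by (auto simp: not_le)
      from bchoice[OF this] obtain s where "\<forall>p\<in>A. s p \<in> B p \<and> \<epsilon> < m (s p) (B p - {s p})"
        by blast
      then have s: "\<And>p. p \<in> A \<Longrightarrow> s p \<in> B p"
          "\<And>p. p \<in> A \<Longrightarrow> m (s p) (B p - {s p}) > \<epsilon>"
        by blast+
      define A' where "A' = s ` A"
      have uniq: "p = q" if "p \<in> A" "q \<in> A" "s q \<in> B p" for p q
        using s(1)[OF that(2)] disj[OF that(1,2)] that(3) by blast
      have sinj: "inj_on s A"
        by (rule inj_onI) (metis s(1) uniq)
      have A'A: "A' \<subseteq> A"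
        unfolding A'_def using BA s(1) by (meson image_subsetI subsetD)
      have "bij_betw s A A'" using sinj by (simp add: A'_def inj_on_imp_bij_betw)
      then have card': "|A'| =o |A|" using card_of_ordIso ordIso_symmetric by blast
      have "m i (A' - {i}) \<le> real n * \<epsilon>" if i: "i \<in> A'" for i
      proof -
        obtain p where p: "p \<in> A" "i = s p" using i by (auto simp: A'_def)
        have AB: "A' \<inter> B p = {i}"
          using s(1) uniq p by (auto simp: A'_def)
        have "m i (A' - {i}) + m i (B p - {i}) \<le> m i ((A' - {i}) \<union> (B p - {i}))"
          by (rule super) (use AB in blast)
        also have "\<dots> \<le> m i ((A' - {i}) \<union> (B p - {i})) +
            m i (A - {i} - ((A' - {i}) \<union> (B p - {i})))"
          using nonneg by simp
        also have "\<dots> \<le> m i ((A' - {i}) \<union> (B p - {i}) \<union>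
            (A - {i} - ((A' - {i}) \<union> (B p - {i}))))"
          by (rule super) blast
        also have "(A' - {i}) \<union> (B p - {i}) \<union> (A - {i} - ((A' - {i}) \<union> (B p - {i}))) = A - {i}"
          using A'A BA[OF p(1)] by blast
        also have "m i (A - {i}) \<le> real (Suc n) * \<epsilon>"
          using Suc.prems(2) i A'A by blast
        finally show ?thesis using s(2)[OF p(1)] p(2) by (simp add: algebra_simps)
      qed
      moreover have "infinite A'"
        using Suc.prems(1) finite_imageD[OF _ sinj] unfolding A'_def by blast
      ultimately obtain J where "J \<subseteq> A'" "|J| =o |A'|" "\<forall>i\<in>J. m i (J - {i}) \<le> \<epsilon>"
        using Suc.IH[of A'] by blast
      then show ?thesis using A'A card' ordIso_transitive by blast
    qed
  qed
  moreover obtain n where n: "M < real n * \<epsilon>"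
    using ex_less_of_nat_mult[OF \<epsilon>, of M] by blast
  then have "m i (A - {i}) \<le> real n * \<epsilon>" for i
    using bound[of i "A - {i}"] by linarith
  ultimately show ?thesis
    using A by blast
qed

text \<open>
  The rows are chosen so that the diagonal entries are large; Rosenthal's lemma, applied to the masses of
  these rows, makes the rest of each row small on the selected indices.
\<close>

lemma diagonal_dominance:
  fixes S :: "('b, 'k::real_normed_field) linfc \<Rightarrow>\<^sub>L ('a, 'k) linfc"
  assumes S: "K_linear S" and A: "infinite A" and c: "c > 0" and \<epsilon>: "\<epsilon> > 0"
    and large: "\<And>i. i \<in> A \<Longrightarrow> norm (S (unit_vec i)) > c"
  shows "\<exists>J \<gamma>. J \<subseteq> A \<and> |J| =o |A| \<and> inj_on \<gamma> J \<and>
    (\<forall>i\<in>J. c < norm (coord (S (unit_vec i)) (\<gamma> i))) \<and>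
    (\<forall>i\<in>J. \<forall>x. (\<forall>j. j \<notin> J - {i} \<longrightarrow> coord x j = 0) \<longrightarrow>
      norm (coord (S x) (\<gamma> i)) \<le> \<epsilon> * norm x)"
proof -
  have "\<exists>\<alpha>. c < norm (coord (S (unit_vec i)) \<alpha>)" if "i \<in> A" for i
    using large[OF that] norm_linfc_le[of "S (unit_vec i)" c] by (force simp: not_less)
  then have "\<forall>i\<in>A. \<exists>\<alpha>. c < norm (coord (S (unit_vec i)) \<alpha>)" by blast
  from bchoice[OF this] obtain \<gamma> where
    \<gamma>: "\<And>i. i \<in> A \<Longrightarrow> norm (coord (S (unit_vec i)) (\<gamma> i)) > c"
    by blast
  define m where "m i B = mass (component S (\<gamma> i)) B" for i B
  define \<delta> where "\<delta> = min \<epsilon> c"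
  have \<delta>: "\<delta> > 0" using c \<epsilon> by (simp add: \<delta>_def)
  have super: "m i B + m i C \<le> m i (B \<union> C)" if "B \<inter> C = {}" for i B C
    unfolding m_def using mass_Un[OF component_functional[OF S] that] by simp
  have bound: "m i B \<le> norm S" for i B
    unfolding m_def by (rule order_trans[OF mass_le_norm norm_component_le])
  have m0: "0 \<le> m i B" for i B unfolding m_def by (rule mass_nonneg)
  obtain J where J: "J \<subseteq> A" "|J| =o |A|" "\<And>i. i \<in> J \<Longrightarrow> m i (J - {i}) \<le> \<delta>"
    using rosenthal_disjointification[of m "norm S" A \<delta>, OF m0 super bound A \<delta>] by blast
  have dom: "norm (coord (S x) (\<gamma> i)) \<le> \<delta> * norm x"
    if "i \<in> J" "\<And>j. j \<notin> J - {i} \<Longrightarrow> coord x j = 0" for i x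
  proof -
    have "norm (component S (\<gamma> i) x) \<le> m i (J - {i}) * norm x"
      unfolding m_def by (rule norm_le_mass[OF that(2)])
    also have "\<dots> \<le> \<delta> * norm x" by (rule mult_right_mono[OF J(3)[OF that(1)]]) simp
    finally show ?thesis by (simp add: component_apply)
  qed
  \<comment> \<open>Two indices with the same row would make a diagonal entry also an off-diagonal one.\<close>
  have "inj_on \<gamma> J"
  proof (rule inj_onI, rule ccontr)
    fix i j assume ij: "i \<in> J" "j \<in> J" "\<gamma> i = \<gamma> j" "i \<noteq> j"
    have "norm (coord (S (unit_vec j)) (\<gamma> i)) \<le> \<delta> * norm (unit_vec j :: ('b, 'k) linfc)"
      by (rule dom) (use ij in auto)
    then have "norm (coord (S (unit_vec j)) (\<gamma> j)) \<le> c"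
      using ij by (simp add: \<delta>_def)
    then show False using \<gamma>[of j] J(1) ij by auto
  qed
  moreover have "norm (coord (S x) (\<gamma> i)) \<le> \<epsilon> * norm x"
    if "i \<in> J" "\<forall>j. j \<notin> J - {i} \<longrightarrow> coord x j = 0" for i x
    using dom[of i x] that mult_right_mono[of \<delta> \<epsilon> "norm x"] by (force simp: \<delta>_def)
  ultimately show ?thesis using J(1,2) \<gamma> by blast
qed

section \<open>Copies of \<open>\<ell>\<^sub>\<infinity>\<^sup>c(\<kappa>)\<close>\<close>

lemma K_subspace_linfc_card: "K_subspace (linfc_card \<kappa>)"
  by (simp add: K_subspace_def linfc_card_def scaleK.rep_eq)

lemma unit_vec_in_linfc_card: "i \<in> Field \<kappa> \<Longrightarrow> unit_vec i \<in> linfc_card \<kappa>"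
  by (auto simp: linfc_card_def)

lemma K_subspace_scaleR: "K_subspace E \<Longrightarrow> x \<in> E \<Longrightarrow> r *\<^sub>R x \<in> E"
  by (simp add: K_subspace_def scaleR_eq_scaleK)

lemma K_subspace_add: "K_subspace E \<Longrightarrow> x \<in> E \<Longrightarrow> y \<in> E \<Longrightarrow> x + y \<in> E"
  by (simp add: K_subspace_def)

lemma K_subspace_diff: "K_subspace E \<Longrightarrow> x \<in> E \<Longrightarrow> y \<in> E \<Longrightarrow> x - y \<in> E"
  using K_subspace_add[of E x "- 1 *\<^sub>R y"] K_subspace_scaleR[of E y "- 1"] by simp

lemma continuous_on_K_subspace_imp_bounded:
  fixes f :: "('a, 'k::real_normed_field) linfc \<Rightarrow> ('b, 'k) linfc"
  assumes E: "K_subspace E" and cont: "continuous_on E f"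
    and add: "\<And>x y. x \<in> E \<Longrightarrow> y \<in> E \<Longrightarrow> f (x + y) = f x + f y"
    and scale: "\<And>c x. x \<in> E \<Longrightarrow> f (c *\<^sub>K x) = c *\<^sub>K f x"
  obtains C where "C > 0" "\<And>x. x \<in> E \<Longrightarrow> norm (f x) \<le> C * norm x"
proof -
  have E0: "0 \<in> E" using E by (simp add: K_subspace_def)
  then have f0: "f 0 = 0" using add[of 0 0] by simp
  have fR: "f (r *\<^sub>R x) = r *\<^sub>R f x" if "x \<in> E" for r x
    using scale[OF that] by (simp add: scaleR_eq_scaleK)
  obtain d where d: "d > 0" "\<And>x. x \<in> E \<Longrightarrow> dist x 0 < d \<Longrightarrow> dist (f x) (f 0) < 1"
    using cont E0 unfolding continuous_on_iff by (metis zero_less_one)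
  have "norm (f x) \<le> (2 / d) * norm x" if x: "x \<in> E" for x
  proof (cases "x = 0")
    case False
    define r where "r = d / (2 * norm x)"
    have r: "r > 0" using False d(1) by (simp add: r_def)
    have "norm (r *\<^sub>R x) = d / 2" using False d(1) by (simp add: r_def)
    then have "norm (f (r *\<^sub>R x)) < 1"
      using d(1) d(2)[OF K_subspace_scaleR[OF E x, of r]] by (simp add: f0)
    then have "r * norm (f x) < 1" using r by (simp add: fR[OF x])
    then show ?thesis using False d(1) by (simp add: r_def field_simps)
  qed (simp add: f0)
  then show ?thesis using that[of "2 / d"] d(1) by simp
qed

text \<open>
  Composing with the projection onto the coordinates in \<open>Field \<kappa>\<close> turns an isomorphism defined on the
  subspace \<open>linfc_card \<kappa>\<close> into an operator on the whole type.
\<close>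

lemma copy_embedding:
  fixes E :: "('a, 'k::real_normed_field) linfc set" and \<kappa> :: "'b rel"
  assumes E: "K_subspace E" and iso: "isomorphic_spaces E (linfc_card \<kappa> :: ('b, 'k) linfc set)"
  obtains S :: "('b, 'k) linfc \<Rightarrow>\<^sub>L ('a, 'k) linfc" and d where "K_linear S" "d > 0"
    "\<And>z. S z \<in> E" "\<And>z. z \<in> linfc_card \<kappa> \<Longrightarrow> d * norm z \<le> norm (S z)"
proof -
  let ?F = "linfc_card \<kappa> :: ('b, 'k) linfc set"
  have F: "K_subspace ?F" by (rule K_subspace_linfc_card)
  obtain U V where hom: "homeomorphism E ?F U V"
    and Uadd: "\<And>x y. x \<in> E \<Longrightarrow> y \<in> E \<Longrightarrow> U (x + y) = U x + U y"
    and Usc: "\<And>c x. x \<in> E \<Longrightarrow> U (c *\<^sub>K x) = c *\<^sub>K U x"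
    using iso unfolding isomorphic_spaces_def by blast
  have VE: "V z \<in> E" and UV: "U (V z) = z" if "z \<in> ?F" for z
    using hom that unfolding homeomorphism_def by auto
  have VU: "V (U x) = x" if "x \<in> E" for x
    using hom that unfolding homeomorphism_def by auto
  have Vadd: "V (x + y) = V x + V y" if "x \<in> ?F" "y \<in> ?F" for x y
  proof -
    have "V (U (V x + V y)) = V x + V y"
      by (rule VU) (use E VE that in \<open>simp add: K_subspace_def\<close>)
    then show ?thesis by (simp add: Uadd VE UV that)
  qed
  have Vsc: "V (c *\<^sub>K x) = c *\<^sub>K V x" if "x \<in> ?F" for c x
  proof -
    have "V (U (c *\<^sub>K V x)) = c *\<^sub>K V x"
      by (rule VU) (use E VE that in \<open>simp add: K_subspace_def\<close>)
    then show ?thesis by (simp add: Usc VE UV that)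
  qed
  obtain C where C: "C > 0" "\<And>x. x \<in> E \<Longrightarrow> norm (U x) \<le> C * norm x"
    using continuous_on_K_subspace_imp_bounded[OF E _ Uadd Usc] hom
    unfolding homeomorphism_def by blast
  obtain D where D: "D > 0" "\<And>z. z \<in> ?F \<Longrightarrow> norm (V z) \<le> D * norm z"
    using continuous_on_K_subspace_imp_bounded[OF F _ Vadd Vsc] hom
    unfolding homeomorphism_def by blast
  let ?P = "proj (Field \<kappa>) :: ('b, 'k) linfc \<Rightarrow>\<^sub>L ('b, 'k) linfc"
  have P: "?P z \<in> ?F" for z by (simp add: linfc_card_def)
  have Pid: "?P z = z" if "z \<in> ?F" for z
    using that by (intro linfc_eqI) (auto simp: linfc_card_def)
  have P_K: "?P (c *\<^sub>K z) = c *\<^sub>K ?P z" for c z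
    using K_linear_proj unfolding K_linear_def by blast
  have bl: "bounded_linear (\<lambda>z. V (?P z))"
  proof (rule bounded_linear_intro[where K = D])
    show "norm (V (?P z)) \<le> norm z * D" for z
      using order_trans[OF D(2)[OF P[of z]] mult_left_mono[OF norm_proj_le less_imp_le[OF D(1)]]]
      by (simp only: mult.commute[of _ D])
    show "V (?P (r *\<^sub>R z)) = r *\<^sub>R V (?P z)" for r z
      by (simp only: scaleR_eq_scaleK P_K Vsc[OF P])
  qed (simp add: blinfun.add_right Vadd P)
  show ?thesis
  proof (rule that[of "Blinfun (\<lambda>z. V (?P z))" "1 / C"])
    show "K_linear (Blinfun (\<lambda>z. V (?P z)))"
      by (simp add: K_linear_def bounded_linear_Blinfun_apply[OF bl] P_K Vsc P)
    show "Blinfun (\<lambda>z. V (?P z)) z \<in> E" for z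
      by (simp add: bounded_linear_Blinfun_apply[OF bl] VE P)
    show "1 / C * norm z \<le> norm (Blinfun (\<lambda>z. V (?P z)) z)" if "z \<in> ?F" for z
      using C(2)[OF VE[OF that]] C(1)
      by (simp add: bounded_linear_Blinfun_apply[OF bl] Pid UV that field_simps)
  qed (use C in simp)
qed

lemma embedding_copy:
  fixes S :: "('b, 'k::real_normed_field) linfc \<Rightarrow>\<^sub>L ('a, 'k) linfc"
  assumes F: "K_subspace F" and S: "K_linear S" and d: "d > 0"
    and below: "\<And>z. z \<in> F \<Longrightarrow> d * norm z \<le> norm (S z)"
  shows "K_subspace (S ` F)" "isomorphic_spaces (S ` F) F"
proof -
  have sc: "S (c *\<^sub>K z) = c *\<^sub>K S z" for c z using S by (simp add: K_linear_def)
  show "K_subspace (S ` F)"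
    unfolding K_subspace_def
  proof (intro conjI ballI allI)
    show "0 \<in> S ` F"
      using F by (auto simp: K_subspace_def intro!: image_eqI[of _ _ 0])
    fix x assume x: "x \<in> S ` F"
    then show "c *\<^sub>K x \<in> S ` F" for c
      using F by (auto simp: K_subspace_def sc[symmetric])
    fix y assume "y \<in> S ` F"
    with x show "x + y \<in> S ` F"
      using F by (auto simp: K_subspace_def blinfun.add_right[symmetric])
  qed
  have lip: "d * norm (x - y) \<le> norm (S x - S y)" if "x \<in> F" "y \<in> F" for x y
    using below[OF K_subspace_diff[OF F that]] by (simp add: blinfun.diff_right)
  have inj: "inj_on S F"
  proof (rule inj_onI)
    fix x y assume "x \<in> F" "y \<in> F" "S x = S y"
    then have "d * norm (x - y) \<le> 0" using lip[of x y] by simp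
    then show "x = y" using d by (simp add: mult_le_0_iff)
  qed
  define U where "U = inv_into F S"
  have US: "U (S z) = z" if "z \<in> F" for z
    using inj that by (simp add: U_def inv_into_f_f)
  have cont: "continuous_on (S ` F) U"
    unfolding continuous_on_iff
  proof (intro ballI allI impI)
    fix x and e :: real assume x: "x \<in> S ` F" and e: "e > 0"
    show "\<exists>\<delta>>0. \<forall>x'\<in>S ` F. dist x' x < \<delta> \<longrightarrow> dist (U x') (U x) < e"
    proof (intro exI[of _ "d * e"] conjI ballI impI)
      fix x' assume x': "x' \<in> S ` F" "dist x' x < d * e"
      obtain z z' where z: "z \<in> F" "x = S z" "z' \<in> F" "x' = S z'" using x x' by blast
      then have "d * norm (z' - z) < d * e"
        using lip[of z' z] x' by (simp add: dist_norm)
      then show "dist (U x') (U x) < e"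
        using z d by (simp add: US dist_norm)
    qed (use d e in simp)
  qed
  show "isomorphic_spaces (S ` F) F"
    unfolding isomorphic_spaces_def
  proof (intro exI conjI)
    show "homeomorphism (S ` F) F U S"
      unfolding homeomorphism_def
      using cont US by (auto intro!: linear_continuous_on blinfun.bounded_linear_right image_eqI)
    show "\<forall>x\<in>S ` F. \<forall>y\<in>S ` F. U (x + y) = U x + U y"
    proof (intro ballI)
      fix x y assume "x \<in> S ` F" "y \<in> S ` F"
      then obtain z w where z: "z \<in> F" "x = S z" "w \<in> F" "y = S w" by blast
      then have "z + w \<in> F" using F by (simp add: K_subspace_def)
      then have "U (S (z + w)) = z + w" by (rule US)
      then show "U (x + y) = U x + U y" using z by (simp add: US blinfun.add_right)
    qed
    show "\<forall>c. \<forall>x\<in>S ` F. U (c *\<^sub>K x) = c *\<^sub>K U x"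
    proof (intro ballI allI)
      fix c x assume "x \<in> S ` F"
      then obtain z where z: "z \<in> F" "x = S z" by blast
      then have "c *\<^sub>K z \<in> F" using F by (simp add: K_subspace_def)
      then have "U (S (c *\<^sub>K z)) = c *\<^sub>K z" by (rule US)
      then show "U (c *\<^sub>K x) = c *\<^sub>K U x" using z by (simp add: US sc)
    qed
  qed
qed

text \<open>
  Let \<open>U\<close> embed \<open>\<ell>\<^sub>\<infinity>\<^sup>c(\<kappa>)\<close> as the given copy.  After diagonal dominance for \<open>T U\<close>, let \<open>R\<close> move \<open>A\<close> to the
  selected indices and let \<open>V\<close> read off the selected coordinates, divided by the diagonal entries.  Then
  \<open>V T U R\<close> is \<open>proj A\<close> up to the off-diagonal part, which can be made as small as desired; since \<open>R\<close>
  and \<open>V\<close> may depend on the error, closedness of the ideal replaces an inversion.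
\<close>

lemma projection_in_ideal:
  fixes I :: "(('a, 'k::real_normed_field) linfc \<Rightarrow>\<^sub>L ('a, 'k) linfc) set"
  assumes I: "operator_ideal I" "closed I" and T: "T \<in> I"
    and E: "K_subspace E" "isomorphic_spaces E (linfc_card \<kappa> :: ('b, 'k) linfc set)"
    and c: "c > 0" "\<And>x. x \<in> E \<Longrightarrow> c * norm x \<le> norm (T x)"
    and A: "infinite A" and \<kappa>: "|Field \<kappa>| =o |A|"
  shows "proj A \<in> I"
proof -
  have IO: "I \<subseteq> operators" and I1: "\<And>A. A \<in> operators \<Longrightarrow> T o\<^sub>L A \<in> I"
    and I2: "\<And>A B. B \<in> I \<Longrightarrow> A \<in> operators \<Longrightarrow> A o\<^sub>L B \<in> I"
    using I(1) T unfolding operator_ideal_def by blast+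
  obtain U :: "('b, 'k) linfc \<Rightarrow>\<^sub>L ('a, 'k) linfc" and d where U: "K_linear U" "d > 0"
    "\<And>z. U z \<in> E" "\<And>z. z \<in> linfc_card \<kappa> \<Longrightarrow> d * norm z \<le> norm (U z)"
    using copy_embedding[OF E] by blast
  obtain h where h: "bij_betw h (Field \<kappa>) A" using \<kappa> card_of_ordIso by blast
  define S where "S = T o\<^sub>L U"
  have S: "K_linear S"
    unfolding S_def using K_linear_compose K_linear_iff_operators IO T U(1) by blast
  define b where "b = c * d / 2"
  have b: "b > 0" using c U(2) by (simp add: b_def)
  have large: "norm (S (unit_vec i)) > b" if "i \<in> Field \<kappa>" for i
  proof -
    have "c * d \<le> c * norm (U (unit_vec i))"
      using U(4)[OF unit_vec_in_linfc_card[OF that]] c(1) by simp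
    also have "\<dots> \<le> norm (S (unit_vec i))" using c(2)[OF U(3)] by (simp add: S_def)
    finally show ?thesis using b by (simp add: b_def)
  qed
  have infF: "infinite (Field \<kappa>)" using A h bij_betw_finite by blast
  have "\<exists>B\<in>I. dist B (proj A) < e" if e: "e > 0" for e
  proof -
    have be: "b * e / 2 > 0" using b e by simp
    obtain J \<gamma> where J: "J \<subseteq> Field \<kappa>" "|J| =o |Field \<kappa>|" "inj_on \<gamma> J"
      "\<forall>i\<in>J. b < norm (coord (S (unit_vec i)) (\<gamma> i))"
      "\<forall>i\<in>J. \<forall>x. (\<forall>j. j \<notin> J - {i} \<longrightarrow> coord x j = 0) \<longrightarrow>
        norm (coord (S x) (\<gamma> i)) \<le> (b * e / 2) * norm x"
      using diagonal_dominance[OF S infF b be large] by blast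
    obtain g where g: "bij_betw g A J"
      using J(2) \<kappa> ordIso_transitive ordIso_symmetric card_of_ordIso by metis
    define g' where "g' = inv_into A g"
    have gJ: "g a \<in> J" and g'g: "g' (g a) = a" if "a \<in> A" for a
      using g that by (auto simp: g'_def bij_betw_def inv_into_f_f)
    have gg': "g (g' j) = j" and g'A: "g' j \<in> A" if "j \<in> J" for j
      using g that by (auto simp: g'_def bij_betw_def f_inv_into_f inv_into_into)
    define R where "R = wcomp g' (\<lambda>j. if j \<in> J then 1 else 0 :: 'k)"
    have admR: "admissible g' (\<lambda>j. if j \<in> J then 1 else 0 :: 'k)"
      by (rule admissible_inj_on[where A = J and B = 1]) (auto intro!: inj_onI, metis gg')
    have R: "coord (R z) j = (if j \<in> J then coord z (g' j) else 0)" for z j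
      by (simp add: R_def wcomp_apply[OF admR])
    define s where "s a = coord (S (unit_vec (g a))) (\<gamma> (g a))" for a
    have s: "norm (s a) > b" if "a \<in> A" for a
      unfolding s_def using J(4) gJ[OF that] by blast
    define w where "w a = (if a \<in> A then inverse (s a) else 0)" for a
    have admV: "admissible (\<lambda>a. \<gamma> (g a)) w"
    proof (rule admissible_inj_on[where A = A and B = "inverse b"])
      show "inj_on (\<lambda>a. \<gamma> (g a)) A"
        using J(3) gJ g'g by (auto simp: inj_on_def) metis
      show "norm (w a) \<le> inverse b" for a
        using s[of a] b by (auto simp: w_def norm_inverse intro!: le_imp_inverse_le)
    qed (simp add: w_def)
    define V where "V = wcomp (\<lambda>a. \<gamma> (g a)) w"
    have V: "coord (V y) a = w a * coord y (\<gamma> (g a))" for y a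
      by (simp add: V_def wcomp_apply[OF admV])
    define B where "B = V o\<^sub>L (T o\<^sub>L (U o\<^sub>L R))"
    have "U o\<^sub>L R \<in> operators" "V \<in> operators"
      using K_linear_compose[OF U(1) K_linear_wcomp[OF admR]] K_linear_wcomp[OF admV]
      by (auto simp: R_def V_def K_linear_iff_operators)
    then have BI: "B \<in> I"
      unfolding B_def by (rule I2[OF I1])
    have Bz: "coord (B z) a = w a * coord (S (R z)) (\<gamma> (g a))" for z a
      by (simp add: B_def V S_def)
    have "norm (B - proj A) \<le> e / 2"
    proof (rule norm_blinfun_bound)
      fix z :: "('a, 'k) linfc"
      show "norm ((B - proj A) z) \<le> e / 2 * norm z"
      proof (rule norm_linfc_le)
        fix a
        show "norm (coord ((B - proj A) z) a) \<le> e / 2 * norm z"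
        proof (cases "a \<in> A")
          case False
          then have "coord ((B - proj A) z) a = 0"
            by (simp add: blinfun.diff_left Bz w_def)
          then show ?thesis using e by simp
        next
          case True
          \<comment> \<open>Split off the diagonal part of \<open>R z\<close>.\<close>
          define x where "x = R z - coord z a *\<^sub>K unit_vec (g a)"
          have x: "coord x j = 0" if "j \<notin> J - {g a}" for j
            using that g'g[OF True] by (cases "j = g a") (auto simp: x_def R scaleK.rep_eq gJ[OF True])
          have nx: "norm x \<le> norm z"
          proof (rule norm_linfc_le)
            show "norm (coord x j) \<le> norm z" for j
              using x[of j] norm_coord_le[of z "g' j"]
              by (cases "j \<in> J - {g a}") (auto simp: x_def R scaleK.rep_eq)
          qed
          have "R z = coord z a *\<^sub>K unit_vec (g a) + x" by (simp add: x_def)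
          then have "S (R z) = coord z a *\<^sub>K S (unit_vec (g a)) + S x"
            using S by (simp add: blinfun.add_right K_linear_def)
          then have "coord (S (R z)) (\<gamma> (g a)) = coord z a * s a + coord (S x) (\<gamma> (g a))"
            by (simp add: scaleK.rep_eq s_def)
          moreover have s0: "s a \<noteq> 0" using s[OF True] b by auto
          ultimately have eq: "coord ((B - proj A) z) a = inverse (s a) * coord (S x) (\<gamma> (g a))"
            using True by (simp add: blinfun.diff_left Bz w_def field_simps)
          have "norm (coord (S x) (\<gamma> (g a))) \<le> (b * e / 2) * norm z"
            using J(5) gJ[OF True] x order_trans[OF _ mult_left_mono[OF nx less_imp_le[OF be]]]
            by blast
          moreover have "norm (inverse (s a)) \<le> inverse b"
            using s[OF True] b by (auto simp: norm_inverse intro!: le_imp_inverse_le)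
          ultimately have "norm (coord ((B - proj A) z) a) \<le> inverse b * ((b * e / 2) * norm z)"
            unfolding eq norm_mult using b by (intro mult_mono) auto
          then show ?thesis using b by (simp add: field_simps)
        qed
      qed
    qed (use e in simp)
    then have "dist B (proj A) < e" using e by (simp add: dist_norm)
    then show ?thesis using BI by blast
  qed
  then have "proj A \<in> closure I" by (auto simp: closure_approachable)
  then show ?thesis using I(2) by simp
qed

text \<open>
  Almost diagonal matrices with large diagonal are bounded below in the supremum norm.  Thus the
  operator \<open>block_op\<close> of a subfamily of full size embeds a copy of \<open>\<ell>\<^sub>\<infinity>\<^sup>c(\<kappa>)\<close> on which \<open>T\<close> is bounded below.
\<close>

lemma disjoint_family_fixes_copy:
  fixes T :: "('a, 'k::real_normed_field) linfc \<Rightarrow>\<^sub>L ('a, 'k) linfc" and \<kappa> :: "'b rel"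
  assumes T: "T \<in> operators" and \<kappa>: "infinite (Field \<kappa>)" and c: "c > 0"
    and disj: "\<And>i j \<alpha>. i \<in> Field \<kappa> \<Longrightarrow> j \<in> Field \<kappa> \<Longrightarrow> coord (x i) \<alpha> \<noteq> 0 \<Longrightarrow>
      coord (x j) \<alpha> \<noteq> 0 \<Longrightarrow> i = j"
    and norm1: "\<And>i. i \<in> Field \<kappa> \<Longrightarrow> norm (x i) \<le> 1"
    and large: "\<And>i. i \<in> Field \<kappa> \<Longrightarrow> norm (T (x i)) > c"
  shows "T \<notin> \<S> (linfc_card \<kappa> :: ('b, 'k) linfc set)"
proof -
  have TK: "K_linear T" using T by (simp add: K_linear_iff_operators)
  define x' where "x' i = (if i \<in> Field \<kappa> then x i else 0)" for i
  have x'1: "norm (x' i) \<le> 1" for i using norm1 by (simp add: x'_def)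
  have x'd: "disjoint_supports x'"
    using disj unfolding disjoint_supports_def x'_def by (auto split: if_splits)
  define S where "S = T o\<^sub>L block_op x'"
  have S: "K_linear S"
    unfolding S_def by (intro K_linear_compose TK K_linear_block[where x = x' and B = 1] x'1)
  have largeS: "norm (S (unit_vec i)) > c" if "i \<in> Field \<kappa>" for i
    using large[OF that] that by (simp add: S_def block_op_unit_vec[OF x'd x'1]) (simp add: x'_def)
  have c2: "c / 2 > 0" using c by simp
  obtain J \<gamma> where J: "J \<subseteq> Field \<kappa>" "|J| =o |Field \<kappa>|" "inj_on \<gamma> J"
      "\<forall>i\<in>J. c < norm (coord (S (unit_vec i)) (\<gamma> i))"
      "\<forall>i\<in>J. \<forall>x. (\<forall>j. j \<notin> J - {i} \<longrightarrow> coord x j = 0) \<longrightarrow>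
        norm (coord (S x) (\<gamma> i)) \<le> (c / 2) * norm x"
    using diagonal_dominance[OF S \<kappa> c c2 largeS] by blast
  have belowJ: "c / 2 * norm y \<le> norm (S y)" if y: "\<And>j. j \<notin> J \<Longrightarrow> coord y j = 0" for y
  proof -
    have "norm (coord y i) \<le> (norm (S y) + c / 2 * norm y) / c" for i
    proof (cases "i \<in> J")
      case True
      define u where "u = y - coord y i *\<^sub>K unit_vec i"
      have u: "coord u j = 0" if "j \<notin> J - {i}" for j
        using that y[of j] by (auto simp: u_def scaleK.rep_eq)
      have nu: "norm u \<le> norm y"
      proof (rule norm_linfc_le)
        show "norm (coord u j) \<le> norm y" for j
          using u[of j] norm_coord_le[of y j]
          by (cases "j = i") (auto simp: u_def scaleK.rep_eq)
      qed
      have "y = coord y i *\<^sub>K unit_vec i + u" by (simp add: u_def)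
      then have "S y = coord y i *\<^sub>K S (unit_vec i) + S u"
        using S unfolding K_linear_def by (metis blinfun.add_right)
      then have eq: "coord y i * coord (S (unit_vec i)) (\<gamma> i)
          = coord (S y) (\<gamma> i) - coord (S u) (\<gamma> i)"
        by (simp add: scaleK.rep_eq)
      have "norm (coord y i) * c \<le> norm (coord y i) * norm (coord (S (unit_vec i)) (\<gamma> i))"
        using J(4) True by (intro mult_left_mono) auto
      also have "\<dots> = norm (coord (S y) (\<gamma> i) - coord (S u) (\<gamma> i))"
        by (simp add: eq[symmetric] norm_mult)
      also have "\<dots> \<le> norm (coord (S y) (\<gamma> i)) + norm (coord (S u) (\<gamma> i))"
        by (rule norm_triangle_ineq4)
      also have "\<dots> \<le> norm (S y) + c / 2 * norm y"
      proof (rule add_mono[OF norm_coord_le])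
        show "norm (coord (S u) (\<gamma> i)) \<le> c / 2 * norm y"
          using J(5) True u order_trans[OF _ mult_left_mono[OF nu less_imp_le[OF c2]]] by blast
      qed
      finally show ?thesis using c by (simp add: field_simps)
    qed (use y c in simp)
    then have "norm y \<le> (norm (S y) + c / 2 * norm y) / c" by (rule norm_linfc_le)
    then show ?thesis using c by (simp add: field_simps)
  qed
  obtain g where g: "bij_betw g J (Field \<kappa>)" using J(2) card_of_ordIso by blast
  define R where "R = wcomp g (\<lambda>j. if j \<in> J then 1 else 0 :: 'k)"
  have admR: "admissible g (\<lambda>j. if j \<in> J then 1 else 0 :: 'k)"
    by (rule admissible_inj_on[where A = J and B = 1]) (use g in \<open>auto simp: bij_betw_def\<close>)
  have R: "coord (R z) j = (if j \<in> J then coord z (g j) else 0)" for z j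
    by (simp add: R_def wcomp_apply[OF admR])
  have nR: "norm z \<le> norm (R z)" if "z \<in> linfc_card \<kappa>" for z
  proof (rule norm_linfc_le)
    fix i
    show "norm (coord z i) \<le> norm (R z)"
    proof (cases "i \<in> Field \<kappa>")
      case True
      then obtain j where "j \<in> J" "i = g j" using g by (auto simp: bij_betw_def)
      then show ?thesis using norm_coord_le[of "R z" j] by (simp add: R)
    qed (use that in \<open>simp add: linfc_card_def\<close>)
  qed
  define \<Phi> where "\<Phi> = block_op x' o\<^sub>L R"
  have \<Phi>: "K_linear \<Phi>"
    unfolding \<Phi>_def R_def by (intro K_linear_compose K_linear_wcomp admR K_linear_block[where x = x' and B = 1] x'1)
  have n\<Phi>: "norm (\<Phi> z) \<le> norm z" for z
  proof -
    have "norm (R z) \<le> norm z"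
      using norm_wcomp_le[OF admR, of 1 z] by (simp add: R_def)
    then show ?thesis
      using norm_block_le[where x = x' and B = 1, OF x'1, of "R z"] by (simp add: \<Phi>_def)
  qed
  have below: "c / 2 * norm z \<le> norm (T (\<Phi> z))" if "z \<in> linfc_card \<kappa>" for z
  proof -
    have "c / 2 * norm z \<le> c / 2 * norm (R z)" using nR[OF that] c by simp
    also have "\<dots> \<le> norm (S (R z))" by (rule belowJ) (simp add: R)
    finally show ?thesis by (simp add: S_def \<Phi>_def)
  qed
  have below\<Phi>: "c / 2 / (norm T + 1) * norm z \<le> norm (\<Phi> z)" if "z \<in> linfc_card \<kappa>" for z
  proof -
    have "norm (T (\<Phi> z)) \<le> (norm T + 1) * norm (\<Phi> z)"
      unfolding distrib_right using norm_blinfun[of T "\<Phi> z"] norm_ge_zero[of "\<Phi> z"] by linarith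
    then have "c / 2 * norm z \<le> (norm T + 1) * norm (\<Phi> z)"
      using below[OF that] by simp
    moreover have "norm T + 1 > 0" using norm_ge_zero[of T] by linarith
    ultimately show ?thesis by (simp add: field_simps)
  qed
  have "norm T + 1 > 0" using norm_ge_zero[of T] by linarith
  then have dpos: "c / 2 / (norm T + 1) > 0" by (intro divide_pos_pos c2)
  have "K_subspace (\<Phi> ` linfc_card \<kappa>)" "isomorphic_spaces (\<Phi> ` linfc_card \<kappa>)
      (linfc_card \<kappa> :: ('b, 'k) linfc set)"
    using embedding_copy[OF K_subspace_linfc_card \<Phi> dpos below\<Phi>] by auto
  moreover have "c / 2 * norm y \<le> norm (T y)" if "y \<in> \<Phi> ` linfc_card \<kappa>" for y
  proof -
    obtain z where z: "z \<in> linfc_card \<kappa>" "y = \<Phi> z" using \<open>y \<in> _\<close> by blast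
    have "c / 2 * norm y \<le> c / 2 * norm z" using n\<Phi>[of z] z c by simp
    then show ?thesis using below[OF z(1)] z by simp
  qed
  moreover have "c / 2 > 0" using c by simp
  ultimately show ?thesis unfolding not_bounded_below_on_copies_def by blast
qed

section \<open>Operators that fix no large copy have almost small support\<close>

text \<open>
  The vectors of the unit ball with \<open>norm (T x) > \<epsilon>\<close> admit no disjoint family of size \<open>\<kappa>\<close>, so the
  supports of a maximal disjoint family of them cover a set \<open>A\<close> smaller than \<open>\<kappa>\<close>; uncountability of \<open>\<kappa>\<close> enters because the
  supports are countable.  Off \<open>A\<close> nothing can be added to the family.
\<close>

lemma small_support_approximation:
  fixes T :: "('a, 'k::real_normed_field) linfc \<Rightarrow>\<^sub>L ('a, 'k) linfc" and \<kappa> :: "'b rel"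
  assumes T: "T \<in> \<S> (linfc_card \<kappa> :: ('b, 'k) linfc set)"
    and \<kappa>: "Cinfinite \<kappa>" "natLeq <o \<kappa>" and \<epsilon>: "\<epsilon> > 0"
  shows "\<exists>A. |A| <o \<kappa> \<and> norm (T - (T o\<^sub>L proj A)) \<le> \<epsilon>"
proof -
  have Top: "T \<in> operators" using T by (simp add: not_bounded_below_on_copies_def)
  define dis where "dis u v \<longleftrightarrow> (\<forall>\<alpha>. coord u \<alpha> = 0 \<or> coord v \<alpha> = 0)"
    for u v :: "('a, 'k) linfc"
  define fam where "fam = {G. (\<forall>u\<in>G. norm u \<le> 1 \<and> norm (T u) > \<epsilon>) \<and>
    (\<forall>u\<in>G. \<forall>v\<in>G. u \<noteq> v \<longrightarrow> dis u v)}"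
  have "\<exists>G\<in>fam. \<forall>X\<in>fam. G \<subseteq> X \<longrightarrow> X = G"
  proof (rule subset_Zorn')
    fix C assume C: "subset.chain fam C"
    then have Cf: "C \<subseteq> fam" and lin: "\<And>X Y. X \<in> C \<Longrightarrow> Y \<in> C \<Longrightarrow> X \<subseteq> Y \<or> Y \<subseteq> X"
      by (auto simp: subset.chain_def)
    have "dis u v" if uv: "u \<in> \<Union> C" "v \<in> \<Union> C" "u \<noteq> v" for u v
    proof -
      obtain X Y where XY: "X \<in> C" "u \<in> X" "Y \<in> C" "v \<in> Y" using uv by blast
      then obtain Z where "Z \<in> C" "u \<in> Z" "v \<in> Z" using lin[of X Y] by blast
      then show ?thesis using Cf uv(3) by (auto simp: fam_def)
    qed
    moreover have "norm u \<le> 1 \<and> norm (T u) > \<epsilon>" if "u \<in> \<Union> C" for u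
      using that Cf by (auto simp: fam_def)
    ultimately show "\<Union> C \<in> fam" by (simp add: fam_def)
  qed
  then obtain G where G: "G \<in> fam" and max: "\<And>X. X \<in> fam \<Longrightarrow> G \<subseteq> X \<Longrightarrow> X = G" by blast
  have Co: "Card_order \<kappa>" and inf\<kappa>: "infinite (Field \<kappa>)"
    using \<kappa>(1) by (auto simp: cinfinite_def)
  have F\<kappa>: "|Field \<kappa>| =o \<kappa>" by (rule card_of_Field_ordIso[OF Co])
  have cardG: "|G| <o \<kappa>"
  proof (rule ccontr)
    assume "\<not> |G| <o \<kappa>"
    then have "\<kappa> \<le>o |G|"
      using Co not_ordLess_iff_ordLeq card_of_Well_order card_order_on_well_order_on by blast
    then have "|Field \<kappa>| \<le>o |G|" using F\<kappa> ordIso_ordLeq_trans by blast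
    then obtain x where x: "inj_on x (Field \<kappa>)" "x ` Field \<kappa> \<subseteq> G"
      using card_of_ordLeq by metis
    have "T \<notin> \<S> (linfc_card \<kappa> :: ('b, 'k) linfc set)"
    proof (rule disjoint_family_fixes_copy[OF Top inf\<kappa> \<epsilon>])
      fix i assume i: "i \<in> Field \<kappa>"
      then have "x i \<in> G" using x(2) by blast
      then show "norm (x i) \<le> 1" "norm (T (x i)) > \<epsilon>" using G by (auto simp: fam_def)
      fix j \<alpha> assume j: "j \<in> Field \<kappa>" "coord (x i) \<alpha> \<noteq> 0" "coord (x j) \<alpha> \<noteq> 0"
      then have "\<not> dis (x i) (x j)" by (auto simp: dis_def)
      moreover have "x j \<in> G" using j x(2) by blast
      ultimately have "x i = x j" using \<open>x i \<in> G\<close> G by (auto simp: fam_def)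
      then show "i = j" using x(1) i j(1) by (simp add: inj_on_def)
    qed
    then show False using T by simp
  qed
  define A where "A = (\<Union>u\<in>G. {\<alpha>. coord u \<alpha> \<noteq> 0})"
  have cs: "countable {\<alpha>. coord u \<alpha> \<noteq> 0}" for u :: "('a, 'k) linfc"
    using coord[of u] by simp
  have cardA: "|A| <o \<kappa>"
  proof (cases "finite G")
    case True
    then have "countable A" unfolding A_def by (intro countable_UN countable_finite cs)
    then have "|A| \<le>o natLeq" by (simp add: countable_card_le_natLeq)
    then show ?thesis using \<kappa>(2) ordLeq_ordLess_trans by blast
  next
    case False
    have "|{\<alpha>. coord u \<alpha> \<noteq> 0}| \<le>o |G|" for u :: "('a, 'k) linfc"
      using cs[of u] False infinite_iff_natLeq_ordLeq countable_card_le_natLeq ordLeq_transitive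
      by blast
    then have "|A| \<le>o |G|"
      unfolding A_def
      by (intro card_of_UNION_ordLeq_infinite[OF False ordIso_imp_ordLeq[OF card_of_refl]] ballI)
    then show ?thesis using cardG ordLeq_ordLess_trans by blast
  qed
  have unit: "norm (T (z - proj A z)) \<le> \<epsilon>" if z: "norm z \<le> 1" for z
  proof (rule ccontr)
    define y where "y = z - proj A z"
    assume "\<not> norm (T (z - proj A z)) \<le> \<epsilon>"
    then have y: "norm (T y) > \<epsilon>" by (simp add: y_def)
    have cy: "coord y \<alpha> = (if \<alpha> \<in> A then 0 else coord z \<alpha>)" for \<alpha>
      by (simp add: y_def)
    have ny: "norm y \<le> 1"
    proof (rule norm_linfc_le)
      show "norm (coord y \<alpha>) \<le> 1" for \<alpha>
        using order_trans[OF norm_coord_le z] by (simp add: cy)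
    qed
    have dy: "dis y u" "dis u y" if "u \<in> G" for u
      using that by (auto simp: dis_def cy A_def)
    have "insert y G \<in> fam"
      using G ny y dy by (auto simp: fam_def)
    then have "y \<in> G" using max[of "insert y G"] by blast
    then have "dis y y" by (rule dy)
    then have "y = 0" by (intro linfc_eqI) (simp add: dis_def)
    then show False using y \<epsilon> by simp
  qed
  have "norm (T - (T o\<^sub>L proj A)) \<le> \<epsilon>"
  proof (rule norm_blinfun_bound)
    fix z :: "('a, 'k) linfc"
    show "norm ((T - (T o\<^sub>L proj A)) z) \<le> \<epsilon> * norm z"
    proof (cases "z = 0")
      case False
      then have "norm (T (z /\<^sub>R norm z - proj A (z /\<^sub>R norm z))) \<le> \<epsilon>"
        by (intro unit) simp
      also have "T (z /\<^sub>R norm z - proj A (z /\<^sub>R norm z)) = T (z - proj A z) /\<^sub>R norm z"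
        by (simp only: blinfun.scaleR_right blinfun.diff_right scaleR_diff_right)
      finally have "norm (T (z - proj A z)) \<le> \<epsilon> * norm z"
        using False by (simp add: divide_simps flip: blinfun.diff_right)
      then show ?thesis
        by (simp add: blinfun.diff_left blinfun.diff_right)
    qed simp
  qed (use \<epsilon> in simp)
  then show ?thesis using cardA by blast
qed

section \<open>Uniform absolute continuity\<close>

text \<open>
  If this failed, there would be sets \<open>E\<^sub>n\<close> that the \<open>n\<close>-th index charges by more than \<open>\<epsilon>\<close> while the
  earlier indices barely charge them.  The masses are only finitely additive, so tails \<open>\<Union>\<^sub>j\<^sub>\<ge>\<^sub>n E\<^sub>j\<close> may be
  large for the earlier indices.  Exhaustivity allows replacing each tail by a finite part \<open>H\<^sub>n\<close> of it
  that misses only a uniformly small piece of every longer one.  The decreasing sets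
  \<open>C\<^sub>n = H\<^sub>0 \<inter> \<dots> \<inter> H\<^sub>n\<close> still carry most of the mass of \<open>E\<^sub>n\<close>, and the differences \<open>C\<^sub>n - C\<^sub>n\<^sub>+\<^sub>1\<close> are
  disjoint sets of large mass.
\<close>

lemma uniform_control:
  fixes m :: "'i \<Rightarrow> 'a set \<Rightarrow> real"
  assumes nonneg: "\<And>i E. 0 \<le> m i E"
    and additive: "\<And>i E F. E \<inter> F = {} \<Longrightarrow> m i (E \<union> F) = m i E + m i F"
    and exhaustive: "\<And>E e. disjoint_family E \<Longrightarrow> e > 0 \<Longrightarrow> \<exists>n::nat. \<forall>i. m i (E n) \<le> e"
    and \<epsilon>: "\<epsilon> > 0"
  shows "\<exists>F \<delta>. finite F \<and> \<delta> > 0 \<and> (\<forall>E. (\<forall>i\<in>F. m i E \<le> \<delta>) \<longrightarrow> (\<forall>i. m i E \<le> \<epsilon>))"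
proof (rule ccontr)
  assume neg: "\<not> ?thesis"
  have mono: "m i E \<le> m i F" if "E \<subseteq> F" for i E F
  proof -
    have "m i (E \<union> (F - E)) = m i E + m i (F - E)" by (rule additive) blast
    moreover have "E \<union> (F - E) = F" using that by blast
    ultimately show ?thesis using nonneg[of i "F - E"] by simp
  qed
  have empty: "m i {} = 0" for i using additive[of "{}" "{}" i] by simp
  have subadd: "m i (E \<union> F) \<le> m i E + m i F" for i E F
  proof -
    have "m i (E \<union> (F - E)) = m i E + m i (F - E)" by (rule additive) blast
    then show ?thesis using mono[of "F - E" F i] by simp
  qed
  have subadd_UN: "m i (\<Union>j\<in>N. E j) \<le> (\<Sum>j\<in>N. m i (E j))" if "finite N"
    for i :: 'i and N :: "nat set" and E
    using that
  proof induction
    case (insert j N)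
    then show ?case using subadd[of i "E j" "\<Union>j\<in>N. E j"] by simp
  qed (simp add: empty)
  have diff: "m i (E - F) \<ge> m i E - m i F" for i E F
    using subadd[of i "E - F" F] mono[of E "E - F \<union> F" i] by simp
  have step: "\<exists>E i. (\<forall>j\<in>F. m j E \<le> \<delta>) \<and> m i E > \<epsilon>" if "finite F" "\<delta> > 0" for F \<delta>
    using neg that by (meson not_le)
  \<comment> \<open>The state is the set of indices used so far, the next set and the index that charges it.\<close>
  define P where "P n s \<longleftrightarrow> finite (fst s) \<and>
      (\<forall>j\<in>fst s. m j (fst (snd s)) \<le> \<epsilon> / 2 ^ (n + 4)) \<and> m (snd (snd s)) (fst (snd s)) > \<epsilon>"
    for n and s :: "'i set \<times> 'a set \<times> 'i"
  define Q where "Q s s' \<longleftrightarrow> fst s' = insert (snd (snd s)) (fst s)"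
    for s s' :: "'i set \<times> 'a set \<times> 'i"
  have "\<exists>s. P 0 s"
  proof -
    obtain E i where "m i E > \<epsilon>" using step[of "{}" 1] by auto
    then have "P 0 ({}, E, i)" by (simp add: P_def)
    then show ?thesis by blast
  qed
  moreover have "\<exists>s'. P (Suc n) s' \<and> Q s s'" if "P n s" for n s
  proof -
    have "finite (insert (snd (snd s)) (fst s))" using that by (simp add: P_def)
    moreover have "\<epsilon> / 2 ^ (Suc n + 4) > 0" using \<epsilon> by simp
    ultimately obtain E i where Ei: "\<forall>j\<in>insert (snd (snd s)) (fst s). m j E \<le> \<epsilon> / 2 ^ (Suc n + 4)"
        "m i E > \<epsilon>"
      using step by blast
    then have "P (Suc n) (insert (snd (snd s)) (fst s), E, i)"
      using that by (simp add: P_def)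
    then show ?thesis by (auto simp: Q_def)
  qed
  ultimately obtain s where s: "\<And>n. P n (s n)" "\<And>n. Q (s n) (s (Suc n))"
    using dependent_nat_choice[of P "\<lambda>_. Q"] by blast
  define F where "F n = fst (s n)" for n
  define E where "E n = fst (snd (s n))" for n
  define \<iota> where "\<iota> n = snd (snd (s n))" for n
  have FS: "F (Suc n) = insert (\<iota> n) (F n)" for n
    using s(2)[of n] by (simp add: Q_def F_def \<iota>_def)
  have \<iota>F: "\<iota> k \<in> F n" if "k < n" for k n
    using that by (induction n) (auto simp: FS less_Suc_eq)
  have Esmall: "m (\<iota> k) (E n) \<le> \<epsilon> / 2 ^ (n + 4)" if "k < n" for k n
    using s(1)[of n] \<iota>F[OF that] by (simp add: P_def F_def E_def)
  have Elarge: "m (\<iota> n) (E n) > \<epsilon>" for n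
    using s(1)[of n] by (simp add: P_def E_def \<iota>_def)
  have geo: "(\<Sum>j\<in>N. \<epsilon> / 2 ^ (j + 3)) \<le> \<epsilon> / 4" if "finite N" for N :: "nat set"
  proof -
    have "(\<Sum>j\<in>N. (1 / 2) ^ j) \<le> (\<Sum>j. (1 / 2 :: real) ^ j)"
      by (rule sum_le_suminf) (use that in \<open>auto intro: summable_geometric\<close>)
    also have "\<dots> = 2" using suminf_geometric[of "1/2 :: real"] by simp
    finally have "\<epsilon> / 8 * (\<Sum>j\<in>N. (1 / 2) ^ j) \<le> \<epsilon> / 8 * 2"
      using \<epsilon> by (intro mult_left_mono) auto
    then show ?thesis by (simp add: sum_distrib_left power_add power_divide mult.commute)
  qed
  \<comment> \<open>Partial unions stabilise up to small sets: otherwise the increments form a disjoint sequence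
     that violates exhaustivity.\<close>
  define H where "H n M = (\<Union>j\<in>{n..M}. E j)" for n M
  have Hmono: "H n M \<subseteq> H n M'" if "M \<le> M'" for n M M'
    unfolding H_def using that by (intro UN_mono) auto
  have "\<exists>M\<ge>n. \<forall>M'\<ge>M. \<forall>i. m i (H n M' - H n M) \<le> e" if e: "e > 0" for n e
  proof (rule ccontr)
    assume "\<not> ?thesis"
    then have bad: "\<exists>M'\<ge>M. \<exists>i. m i (H n M' - H n M) > e" if "M \<ge> n" for M
      using that by (meson not_le)
    have "\<exists>M. \<forall>k. M k \<ge> n \<and> (M (Suc k) \<ge> M k \<and> (\<exists>i. m i (H n (M (Suc k)) - H n (M k)) > e))"
    proof (rule dependent_nat_choice)
      show "\<exists>M. M \<ge> n" by blast
      show "\<exists>M'. M' \<ge> n \<and> (M' \<ge> M \<and> (\<exists>i. m i (H n M' - H n M) > e))" if "M \<ge> n" for M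
        using bad[OF that] that order_trans by meson
    qed
    then obtain M where M: "\<And>k. M (Suc k) \<ge> M k" "\<And>k. \<exists>i. m i (H n (M (Suc k)) - H n (M k)) > e"
      by blast
    have incM: "M j \<le> M k" if "j \<le> k" for j k
      using that M(1) by (rule lift_Suc_mono_le[rotated])
    have "disjoint_family (\<lambda>k. H n (M (Suc k)) - H n (M k))"
    proof -
      have "(H n (M (Suc j)) - H n (M j)) \<inter> (H n (M (Suc k)) - H n (M k)) = {}" if "j < k" for j k
        using Hmono[OF incM[of "Suc j" k], of n] that by auto
      then show ?thesis
        unfolding disjoint_family_on_def by (metis Int_commute linorder_neqE_nat)
    qed
    from exhaustive[OF this e] show False using M(2) by (meson not_le)
  qed
  then have "\<exists>M\<ge>n. \<forall>M'\<ge>M. \<forall>i. m i (H n M' - H n M) \<le> \<epsilon> / 2 ^ (n + 3)" for n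
    using \<epsilon> by simp
  then obtain M where M: "\<And>n. M n \<ge> n"
      "\<And>n M' i. M' \<ge> M n \<Longrightarrow> m i (H n M' - H n (M n)) \<le> \<epsilon> / 2 ^ (n + 3)"
    by metis
  define C where "C n = (\<Inter>j\<in>{..n}. H j (M j))" for n
  have Cdec: "C k \<subseteq> C n" if "n \<le> k" for n k
    using that by (auto simp: C_def)
  have Clarge: "m (\<iota> n) (C n) \<ge> 3 / 4 * \<epsilon>" for n
  proof -
    have miss: "m (\<iota> n) (E n - H j (M j)) \<le> \<epsilon> / 2 ^ (j + 3)" if "j \<le> n" for j
    proof -
      have "E n - H j (M j) \<subseteq> H j (max n (M j)) - H j (M j)"
        using that by (auto simp: H_def)
      then show ?thesis by (rule order_trans[OF mono M(2)]) simp
    qed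
    have "m (\<iota> n) (E n - C n) \<le> m (\<iota> n) (\<Union>j\<in>{..n}. E n - H j (M j))"
      by (rule mono) (auto simp: C_def)
    also have "\<dots> \<le> (\<Sum>j\<in>{..n}. m (\<iota> n) (E n - H j (M j)))" by (rule subadd_UN) simp
    also have "\<dots> \<le> (\<Sum>j\<in>{..n}. \<epsilon> / 2 ^ (j + 3))" by (rule sum_mono) (simp add: miss)
    also have "\<dots> \<le> \<epsilon> / 4" by (rule geo) simp
    finally have "m (\<iota> n) (E n - C n) \<le> \<epsilon> / 4" .
    then show ?thesis using diff[of "\<iota> n" "E n" "C n"] Elarge[of n] by linarith
  qed
  have Csmall: "m (\<iota> n) (C (Suc n)) \<le> \<epsilon> / 8" for n
  proof -
    have "m (\<iota> n) (C (Suc n)) \<le> m (\<iota> n) (H (Suc n) (M (Suc n)))"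
      by (rule mono) (auto simp: C_def)
    also have "\<dots> \<le> (\<Sum>j\<in>{Suc n..M (Suc n)}. m (\<iota> n) (E j))"
      unfolding H_def by (rule subadd_UN) simp
    also have "\<dots> \<le> (\<Sum>j\<in>{Suc n..M (Suc n)}. \<epsilon> / 2 ^ (j + 4))"
      by (rule sum_mono) (simp add: Esmall)
    also have "\<dots> = (\<Sum>j\<in>{Suc n..M (Suc n)}. \<epsilon> / 2 ^ (j + 3)) / 2"
      by (simp add: sum_divide_distrib power_add mult.commute)
    also have "\<dots> \<le> \<epsilon> / 8" using geo[of "{Suc n..M (Suc n)}"] by simp
    finally show ?thesis .
  qed
  have "disjoint_family (\<lambda>n. C n - C (Suc n))"
  proof -
    have "(C j - C (Suc j)) \<inter> (C k - C (Suc k)) = {}" if "j < k" for j k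
      using Cdec[of "Suc j" k] that by auto
    then show ?thesis
      unfolding disjoint_family_on_def by (metis Int_commute linorder_neqE_nat)
  qed
  moreover have "\<epsilon> / 2 > 0" using \<epsilon> by simp
  ultimately obtain n where "\<forall>i. m i (C n - C (Suc n)) \<le> \<epsilon> / 2" using exhaustive by blast
  then have "m (\<iota> n) (C n) - m (\<iota> n) (C (Suc n)) \<le> \<epsilon> / 2"
    using diff[of "\<iota> n" "C n" "C (Suc n)"] order_trans[of _ "m (\<iota> n) (C n - C (Suc n))"] by blast
  then show False using Clarge[of n] Csmall[of n] \<epsilon> by linarith
qed

section \<open>Weak compactness\<close>

lemma linfc_Cauchy_convergent:
  fixes X :: "nat \<Rightarrow> ('a, 'k::{real_normed_field, banach}) linfc"
  assumes "Cauchy X"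
  shows "\<exists>L. X \<longlonglongrightarrow> L"
proof -
  have cd: "norm (coord (X n) \<alpha> - coord (X m) \<alpha>) \<le> norm (X n - X m)" for n m \<alpha>
    using norm_coord_le[of "X n - X m" \<alpha>] by simp
  have "Cauchy (\<lambda>n. coord (X n) \<alpha>)" for \<alpha>
  proof (rule CauchyI)
    fix e :: real assume "e > 0"
    then obtain M where "\<And>m n. m \<ge> M \<Longrightarrow> n \<ge> M \<Longrightarrow> norm (X m - X n) < e"
      using CauchyD[OF assms] by blast
    then show "\<exists>M. \<forall>m\<ge>M. \<forall>n\<ge>M. norm (coord (X m) \<alpha> - coord (X n) \<alpha>) < e"
      using cd le_less_trans by blast
  qed
  then have "\<forall>\<alpha>. \<exists>l. (\<lambda>n. coord (X n) \<alpha>) \<longlonglongrightarrow> l"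
    by (simp add: Cauchy_convergent_iff convergent_def)
  from choice[OF this] obtain l where l: "\<And>\<alpha>. (\<lambda>n. coord (X n) \<alpha>) \<longlonglongrightarrow> l \<alpha>" by blast
  have unif: "\<exists>M. \<forall>n\<ge>M. \<forall>\<alpha>. norm (coord (X n) \<alpha> - l \<alpha>) \<le> e" if e: "e > 0" for e
  proof -
    obtain M where M: "\<And>m n. m \<ge> M \<Longrightarrow> n \<ge> M \<Longrightarrow> norm (X m - X n) < e"
      using CauchyD[OF assms e] by blast
    have "norm (coord (X n) \<alpha> - l \<alpha>) \<le> e" if n: "n \<ge> M" for n \<alpha>
    proof (rule LIMSEQ_le_const2)
      show "(\<lambda>m. norm (coord (X n) \<alpha> - coord (X m) \<alpha>)) \<longlonglongrightarrow> norm (coord (X n) \<alpha> - l \<alpha>)"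
        by (intro tendsto_intros l)
      have "norm (coord (X n) \<alpha> - coord (X m) \<alpha>) \<le> e" if "m \<ge> M" for m
        using cd[of n \<alpha> m] M[OF n that] by linarith
      then show "\<exists>N. \<forall>m\<ge>N. norm (coord (X n) \<alpha> - coord (X m) \<alpha>) \<le> e" by blast
    qed
    then show ?thesis by blast
  qed
  have "countable {\<alpha>. l \<alpha> \<noteq> 0}"
  proof (rule countable_subset)
    have "l \<alpha> = 0" if "\<And>n. coord (X n) \<alpha> = 0" for \<alpha>
      using l[of \<alpha>] that by (simp add: LIMSEQ_const_iff)
    then show "{\<alpha>. l \<alpha> \<noteq> 0} \<subseteq> (\<Union>n. {\<alpha>. coord (X n) \<alpha> \<noteq> 0})" by blast
    show "countable (\<Union>n. {\<alpha>. coord (X n) \<alpha> \<noteq> 0})" using coord[of "X _"] by simp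
  qed
  moreover have "bounded (range l)"
  proof -
    obtain M where M: "\<And>\<alpha>. norm (coord (X M) \<alpha> - l \<alpha>) \<le> 1" using unif[of 1] by auto
    have "norm (l \<alpha>) \<le> norm (X M) + 1" for \<alpha>
      using M[of \<alpha>] norm_coord_le[of "X M" \<alpha>] norm_triangle_sub[of "l \<alpha>" "coord (X M) \<alpha>"]
      by (simp add: norm_minus_commute)
    then show ?thesis by (auto intro: boundedI)
  qed
  ultimately have cl: "coord (Abs_linfc l) = l" by (subst Abs_linfc_inverse) auto
  have "X \<longlonglongrightarrow> Abs_linfc l"
  proof (rule LIMSEQ_I)
    fix e :: real assume e: "e > 0"
    then obtain M where M: "\<And>n \<alpha>. n \<ge> M \<Longrightarrow> norm (coord (X n) \<alpha> - l \<alpha>) \<le> e / 2"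
      using unif[of "e / 2"] by auto
    have "norm (X n - Abs_linfc l) \<le> e / 2" if "n \<ge> M" for n
      by (rule norm_linfc_le) (use M[OF that] in \<open>simp add: cl\<close>)
    then show "\<exists>M. \<forall>n\<ge>M. norm (X n - Abs_linfc l) < e"
      using e by (intro exI[of _ M]) fastforce
  qed
  then show ?thesis by blast
qed

text \<open>
  The quadratic form \<open>\<integral>|x|\<^sup>2 d|\<phi>|\<close>.
\<close>

definition quad :: "(('b, 'k::real_normed_field) linfc \<Rightarrow>\<^sub>L 'k) \<Rightarrow> ('b, 'k) linfc \<Rightarrow> real"
  where "quad \<phi> x = variation \<phi> (\<lambda>\<alpha>. (norm (coord x \<alpha>))\<^sup>2)"

lemma quad_bound: "(norm (coord x \<alpha>))\<^sup>2 \<le> (norm x)\<^sup>2"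
  by (simp add: norm_coord_le power_mono)

lemma quad_nonneg: "0 \<le> quad \<phi> x"
  unfolding quad_def by (rule variation_nonneg[where B = "(norm x)\<^sup>2"]) (simp_all add: quad_bound)

lemma quad_le: "quad \<phi> x \<le> norm \<phi> * (norm x)\<^sup>2"
  unfolding quad_def by (rule variation_le) (simp_all add: quad_bound)

lemma quad_parallelogram:
  fixes \<phi> :: "('b, 'k::{real_normed_field, real_inner}) linfc \<Rightarrow>\<^sub>L 'k"
  assumes \<phi>: "\<phi> \<in> functionals"
  shows "quad \<phi> (x + y) + quad \<phi> (x - y) = 2 * quad \<phi> x + 2 * quad \<phi> y"
proof -
  have add: "variation \<phi> (\<lambda>\<alpha>. (norm (coord u \<alpha>))\<^sup>2 + (norm (coord v \<alpha>))\<^sup>2) = quad \<phi> u + quad \<phi> v"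
    for u v
    unfolding quad_def
    by (rule variation_add[OF \<phi>, where B = "(norm u)\<^sup>2" and C = "(norm v)\<^sup>2"])
      (simp_all add: quad_bound)
  let ?s = "\<lambda>\<alpha>. (norm (coord x \<alpha>))\<^sup>2 + (norm (coord y \<alpha>))\<^sup>2"
  have "(norm (coord (x + y) \<alpha>))\<^sup>2 + (norm (coord (x - y) \<alpha>))\<^sup>2 = ?s \<alpha> + ?s \<alpha>" for \<alpha>
    by (simp add: power2_norm_eq_inner inner_add inner_diff inner_commute)
  then have "quad \<phi> (x + y) + quad \<phi> (x - y) = variation \<phi> (\<lambda>\<alpha>. ?s \<alpha> + ?s \<alpha>)"
    by (simp flip: add)
  also have "\<dots> = variation \<phi> ?s + variation \<phi> ?s"
    by (rule variation_add[OF \<phi>, where B = "(norm x)\<^sup>2 + (norm y)\<^sup>2"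
          and C = "(norm x)\<^sup>2 + (norm y)\<^sup>2"])
      (simp_all add: add_mono quad_bound)
  finally show ?thesis by (simp add: add)
qed

lemma chebyshev:
  assumes \<eta>: "\<eta> > 0"
  shows "\<eta>\<^sup>2 * mass \<phi> {\<alpha>. norm (coord x \<alpha>) > \<eta>} \<le> quad \<phi> x"
proof -
  let ?E = "{\<alpha>. norm (coord x \<alpha>) > \<eta>}"
  have "\<eta>\<^sup>2 * mass \<phi> ?E \<le> variation \<phi> (\<lambda>\<alpha>. \<eta>\<^sup>2 * indicat_real ?E \<alpha>)"
    unfolding mass_def by (rule variation_scale_ge[where B = 1]) (use \<eta> in auto)
  also have "\<dots> \<le> quad \<phi> x"
    unfolding quad_def
  proof (rule variation_mono)
    show "\<eta>\<^sup>2 * indicat_real ?E \<alpha> \<le> (norm (coord x \<alpha>))\<^sup>2" for \<alpha>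
      using \<eta> by (auto simp: indicator_def intro!: power_mono)
  qed (auto intro: quad_bound)
  finally show ?thesis .
qed

text \<open>
  Mass that stays above \<open>e\<close> on each of infinitely many disjoint sets is witnessed by a disjoint sequence
  of vectors that \<open>T\<close> keeps away from \<open>0\<close>.
\<close>

lemma fixes_no_countable_copy_imp_exhaustive:
  fixes T :: "('a, 'k::real_normed_field) linfc \<Rightarrow>\<^sub>L ('a, 'k) linfc" and \<kappa> :: "'b rel"
  assumes T: "T \<in> \<S> (linfc_card \<kappa> :: ('b, 'k) linfc set)"
    and \<kappa>: "infinite (Field \<kappa>)" "countable (Field \<kappa>)"
    and E: "disjoint_family E" and e: "e > 0"
  shows "\<exists>n::nat. \<forall>\<gamma>. mass (component T \<gamma>) (E n) \<le> e"
proof (rule ccontr)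
  assume neg: "\<not> ?thesis"
  have Top: "T \<in> operators" using T by (simp add: not_bounded_below_on_copies_def)
  have "\<exists>x. (\<forall>\<alpha>. \<alpha> \<notin> E n \<longrightarrow> coord x \<alpha> = 0) \<and> norm x \<le> 1 \<and> norm (T x) > e" for n
  proof -
    obtain \<gamma> where "mass (component T \<gamma>) (E n) > e" using neg by (meson not_le)
    then obtain x where x: "\<And>\<alpha>. \<alpha> \<notin> E n \<Longrightarrow> coord x \<alpha> = 0" "norm x \<le> 1" "norm (component T \<gamma> x) > e"
      using mass_witness by blast
    then have "norm (T x) > e" using norm_coord_le[of "T x" \<gamma>] by (simp add: component_apply)
    then show ?thesis using x by blast
  qed
  then have "\<forall>n. \<exists>x. (\<forall>\<alpha>. \<alpha> \<notin> E n \<longrightarrow> coord x \<alpha> = 0) \<and> norm x \<le> 1 \<and> norm (T x) > e" by blast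
  from choice[OF this] obtain x where
    x: "\<And>n \<alpha>. \<alpha> \<notin> E n \<Longrightarrow> coord (x n) \<alpha> = 0" "\<And>n. norm (x n) \<le> 1" "\<And>n. norm (T (x n)) > e"
    by blast
  let ?f = "to_nat_on (Field \<kappa>)"
  have "T \<notin> \<S> (linfc_card \<kappa> :: ('b, 'k) linfc set)"
  proof (rule disjoint_family_fixes_copy[OF Top \<kappa>(1) e, where x = "\<lambda>i. x (?f i)"])
    fix i j \<alpha> assume ij: "i \<in> Field \<kappa>" "j \<in> Field \<kappa>"
      "coord (x (?f i)) \<alpha> \<noteq> 0" "coord (x (?f j)) \<alpha> \<noteq> 0"
    then have "\<alpha> \<in> E (?f i) \<inter> E (?f j)" using x(1) by blast
    then have "?f i = ?f j" using E by (auto simp: disjoint_family_on_def)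
    then show "i = j" using ij inj_on_to_nat_on[OF \<kappa>(2)] by (simp add: inj_on_def)
  qed (use x in auto)
  then show False using T by simp
qed

text \<open>
  Enumerate the finite sets that control the accuracies \<open>1 / (n + 1)\<close>, so that a single sequence of
  components serves every accuracy.
\<close>

lemma control_sequence:
  fixes T :: "('a, 'k::real_normed_field) linfc \<Rightarrow>\<^sub>L ('a, 'k) linfc"
  assumes T: "T \<in> operators"
    and ex: "\<And>E e. disjoint_family E \<Longrightarrow> e > 0 \<Longrightarrow> \<exists>n::nat. \<forall>\<gamma>. mass (component T \<gamma>) (E n) \<le> e"
  shows "\<exists>\<gamma>. \<forall>\<epsilon>>0. \<exists>N. \<exists>\<delta>>0. \<forall>E. (\<forall>k\<le>N::nat. mass (component T (\<gamma> k)) E \<le> \<delta>) \<longrightarrow>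
    (\<forall>\<beta>. mass (component T \<beta>) E \<le> \<epsilon>)"
proof -
  have TK: "K_linear T" using T by (simp add: K_linear_iff_operators)
  have uc: "\<exists>F \<delta>. finite F \<and> \<delta> > 0 \<and>
      (\<forall>E. (\<forall>i\<in>F. mass (component T i) E \<le> \<delta>) \<longrightarrow> (\<forall>i. mass (component T i) E \<le> \<epsilon>))" if "\<epsilon> > 0" for \<epsilon>
    by (rule uniform_control[OF mass_nonneg mass_Un[OF component_functional[OF TK]] ex that])
  then have "\<forall>n. \<exists>F \<delta>. finite F \<and> \<delta> > 0 \<and>
      (\<forall>E. (\<forall>i\<in>F. mass (component T i) E \<le> \<delta>) \<longrightarrow> (\<forall>i. mass (component T i) E \<le> 1 / real (Suc n)))"
    by simp
  then obtain F \<delta> where F: "\<And>n. finite (F n)" "\<And>n. \<delta> n > 0"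
    "\<And>n E. (\<forall>i\<in>F n. mass (component T i) E \<le> \<delta> n) \<Longrightarrow> \<forall>i. mass (component T i) E \<le> 1 / real (Suc n)"
    by metis
  define G where "G = insert undefined (\<Union>n. F n)"
  have cG: "countable G" and neG: "G \<noteq> {}"
    using F(1) by (auto simp: G_def intro: countable_finite)
  define \<gamma> where "\<gamma> = from_nat_into G"
  have r: "range \<gamma> = G" unfolding \<gamma>_def by (rule range_from_nat_into[OF neG cG])
  have "\<exists>N. \<exists>\<delta>>0. \<forall>E. (\<forall>k\<le>N. mass (component T (\<gamma> k)) E \<le> \<delta>) \<longrightarrow> (\<forall>\<beta>. mass (component T \<beta>) E \<le> \<epsilon>)"
    if \<epsilon>: "\<epsilon> > 0" for \<epsilon>
  proof -
    obtain n where n: "1 / real (Suc n) < \<epsilon>" using nat_approx_posE[OF \<epsilon>] by blast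
    have sub: "F n \<subseteq> \<gamma> ` UNIV" using r by (auto simp: G_def)
    obtain D where D: "finite D" "F n = \<gamma> ` D"
      using finite_subset_image[OF F(1) sub] by blast
    obtain N where N: "D \<subseteq> {..N}" using D(1) finite_nat_iff_bounded_le[of D] by blast
    have "mass (component T \<beta>) E \<le> \<epsilon>" if "\<forall>k\<le>N. mass (component T (\<gamma> k)) E \<le> \<delta> n" for E \<beta>
    proof -
      have "\<forall>i\<in>F n. mass (component T i) E \<le> \<delta> n" using D(2) N that by auto
      then have "mass (component T \<beta>) E \<le> 1 / real (Suc n)" using F(3)[of n E] by blast
      then show ?thesis using n by simp
    qed
    then show ?thesis using F(2) by blast
  qed
  then show ?thesis by blast
qed

text \<open>
  The form \<open>q\<close> is a weighted sum of the forms of the controlling components.  If \<open>q x\<close> is small, then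
  by Chebyshev's inequality these components have little mass where \<open>|x|\<close> exceeds a small threshold, so
  \<open>T\<close> is small on that part of \<open>x\<close>; the remaining part of \<open>x\<close> is small itself.
\<close>

lemma hilbertian_control:
  fixes T :: "('a, 'k::{real_normed_field, real_inner}) linfc \<Rightarrow>\<^sub>L ('a, 'k) linfc"
  assumes T: "T \<in> operators"
    and ex: "\<And>E e. disjoint_family E \<Longrightarrow> e > 0 \<Longrightarrow> \<exists>n::nat. \<forall>\<gamma>. mass (component T \<gamma>) (E n) \<le> e"
  shows "\<exists>(q :: ('a, 'k) linfc \<Rightarrow> real) B. (\<forall>x. 0 \<le> q x) \<and> (\<forall>x. norm x \<le> 1 \<longrightarrow> q x \<le> B) \<and>
    (\<forall>x y. q (x + y) + q (x - y) = 2 * q x + 2 * q y) \<and>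
    (\<forall>\<epsilon>>0. \<exists>\<delta>>0. \<forall>x. norm x \<le> 1 \<longrightarrow> q x \<le> \<delta> \<longrightarrow> norm (T x) \<le> \<epsilon>)"
proof -
  have TK: "K_linear T" using T by (simp add: K_linear_iff_operators)
  note rf = component_functional[OF TK]
  obtain \<gamma> where \<gamma>: "\<And>\<epsilon>. \<epsilon> > 0 \<Longrightarrow> \<exists>N. \<exists>\<delta>>0. \<forall>E. (\<forall>k\<le>N::nat. mass (component T (\<gamma> k)) E \<le> \<delta>) \<longrightarrow>
    (\<forall>\<beta>. mass (component T \<beta>) E \<le> \<epsilon>)"
    using control_sequence[OF T ex] by blast
  define t where "t x k = (1 / 2) ^ k * quad (component T (\<gamma> k)) x" for x k
  define q where "q x = (\<Sum>k. t x k)" for x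
  have t0: "0 \<le> t x k" for x k by (simp add: t_def quad_nonneg)
  have tle: "t x k \<le> (1 / 2) ^ k * (norm T * (norm x)\<^sup>2)" for x k
  proof -
    have "quad (component T (\<gamma> k)) x \<le> norm T * (norm x)\<^sup>2"
      using order_trans[OF quad_le mult_right_mono[OF norm_component_le]] by simp
    then show ?thesis unfolding t_def by (intro mult_left_mono) auto
  qed
  have sg: "summable (\<lambda>k. (1 / 2 :: real) ^ k * c)" for c
    by (intro summable_mult2 summable_geometric) simp
  have st: "summable (t x)" for x
    by (rule summable_comparison_test[OF _ sg[of "norm T * (norm x)\<^sup>2"]]) (use t0 tle in auto)
  have q0: "0 \<le> q x" for x unfolding q_def by (rule suminf_nonneg[OF st t0])
  have qB: "q x \<le> 2 * norm T" if x: "norm x \<le> 1" for x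
  proof -
    have "(norm x)\<^sup>2 \<le> 1" using x by (simp add: power_le_one)
    then have "norm T * (norm x)\<^sup>2 \<le> norm T" using mult_left_mono[of "(norm x)\<^sup>2" 1 "norm T"] by simp
    then have "t x k \<le> (1 / 2) ^ k * norm T" for k
      using tle[of x k] by (meson mult_left_mono order_trans zero_le_divide_1_iff zero_le_numeral
          zero_le_power)
    then have "q x \<le> (\<Sum>k. (1 / 2) ^ k * norm T)"
      unfolding q_def by (intro suminf_le st sg)
    also have "\<dots> = (\<Sum>k. (1 / 2) ^ k) * norm T"
      by (rule suminf_mult2[symmetric]) (simp add: summable_geometric)
    also have "(\<Sum>k. (1 / 2 :: real) ^ k) = 2" by (simp add: suminf_geometric)
    finally show ?thesis .
  qed
  have par: "q (x + y) + q (x - y) = 2 * q x + 2 * q y" for x y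
  proof -
    have "t (x + y) k + t (x - y) k = 2 * t x k + 2 * t y k" for k
    proof -
      let ?\<phi> = "component T (\<gamma> k)"
      have "t (x + y) k + t (x - y) k = (1 / 2) ^ k * (quad ?\<phi> (x + y) + quad ?\<phi> (x - y))"
        by (simp add: t_def distrib_left)
      also have "\<dots> = (1 / 2) ^ k * (2 * quad ?\<phi> x + 2 * quad ?\<phi> y)"
        by (simp only: quad_parallelogram[OF rf])
      finally show ?thesis by (simp add: t_def distrib_left)
    qed
    then have "(\<Sum>k. t (x + y) k + t (x - y) k) = (\<Sum>k. 2 * t x k + 2 * t y k)" by simp
    then show ?thesis
      unfolding q_def suminf_add[OF st st] suminf_mult[OF st, symmetric]
        suminf_add[OF summable_mult[OF st] summable_mult[OF st]] .
  qed
  have ctrl: "\<exists>\<delta>>0. \<forall>x. norm x \<le> 1 \<longrightarrow> q x \<le> \<delta> \<longrightarrow> norm (T x) \<le> \<epsilon>" if \<epsilon>: "\<epsilon> > 0" for \<epsilon>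
  proof -
    define \<eta> where "\<eta> = \<epsilon> / (2 * (norm T + 1))"
    have T1: "norm T + 1 > 0" using norm_ge_zero[of T] by linarith
    have \<eta>: "\<eta> > 0" using \<epsilon> T1 by (simp add: \<eta>_def)
    have T\<eta>: "norm T * \<eta> \<le> \<epsilon> / 2"
    proof -
      have "norm T * \<eta> \<le> (norm T + 1) * \<eta>" using \<eta> by simp
      also have "\<dots> = \<epsilon> / 2" using T1 by (simp add: \<eta>_def field_simps)
      finally show ?thesis .
    qed
    have "\<epsilon> / 2 > 0" using \<epsilon> by simp
    from \<gamma>[OF this] obtain N \<delta> where N: "\<delta> > 0"
      "\<forall>E. (\<forall>k\<le>N. mass (component T (\<gamma> k)) E \<le> \<delta>) \<longrightarrow> (\<forall>\<beta>. mass (component T \<beta>) E \<le> \<epsilon> / 2)"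
      by blast
    define d where "d = \<delta> * \<eta>\<^sup>2 * (1 / 2) ^ N"
    have "norm (T x) \<le> \<epsilon>" if x: "norm x \<le> 1" "q x \<le> d" for x
    proof -
      define E where "E = {\<alpha>. norm (coord x \<alpha>) > \<eta>}"
      have "mass (component T (\<gamma> k)) E \<le> \<delta>" if k: "k \<le> N" for k
      proof -
        have "t x k \<le> q x"
          unfolding q_def using sum_le_suminf[OF st, of "{k}" x] t0 by simp
        have "(1 / 2) ^ k * (\<eta>\<^sup>2 * mass (component T (\<gamma> k)) E) \<le> t x k"
          unfolding t_def E_def by (intro mult_left_mono chebyshev[OF \<eta>]) simp
        also have "\<dots> \<le> d" using \<open>t x k \<le> q x\<close> x(2) by simp
        also have "d \<le> \<delta> * \<eta>\<^sup>2 * (1 / 2) ^ k"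
          unfolding d_def using N(1) k by (intro mult_left_mono power_decreasing) auto
        finally show ?thesis using \<eta> by (simp add: field_simps)
      qed
      then have mE: "mass (component T \<beta>) E \<le> \<epsilon> / 2" for \<beta> using N(2) by blast
      have "norm (T (proj E x)) \<le> \<epsilon> / 2"
      proof (rule norm_linfc_le)
        fix \<beta>
        have "norm (component T \<beta> (proj E x)) \<le> mass (component T \<beta>) E * norm (proj E x)"
          by (rule norm_le_mass) simp
        also have "\<dots> \<le> \<epsilon> / 2 * 1"
          using mE[of \<beta>] order_trans[OF norm_proj_le x(1)] \<epsilon> by (intro mult_mono) auto
        finally show "norm (coord (T (proj E x)) \<beta>) \<le> \<epsilon> / 2" by (simp add: component_apply)
      qed
      moreover have "norm (x - proj E x) \<le> \<eta>"
        by (rule norm_linfc_le) (use \<eta> in \<open>auto simp: E_def\<close>)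
      then have "norm T * norm (x - proj E x) \<le> norm T * \<eta>" by (rule mult_left_mono) simp
      then have "norm (T (x - proj E x)) \<le> \<epsilon> / 2"
        using norm_blinfun[of T "x - proj E x"] T\<eta> by linarith
      moreover have "T x = T (proj E x) + T (x - proj E x)" by (simp flip: blinfun.add_right)
      ultimately show ?thesis
        using norm_triangle_ineq[of "T (proj E x)" "T (x - proj E x)"] by simp
    qed
    moreover have "d > 0" using N(1) \<eta> by (simp add: d_def)
    ultimately show ?thesis by blast
  qed
  show ?thesis
  proof (intro exI conjI)
    show "\<forall>x. 0 \<le> q x" using q0 by blast
    show "\<forall>x. norm x \<le> 1 \<longrightarrow> q x \<le> 2 * norm T" using qB by blast
    show "\<forall>x y. q (x + y) + q (x - y) = 2 * q x + 2 * q y" using par by blast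
    show "\<forall>\<epsilon>>0. \<exists>\<delta>>0. \<forall>x. norm x \<le> 1 \<longrightarrow> q x \<le> \<delta> \<longrightarrow> norm (T x) \<le> \<epsilon>" using ctrl by blast
  qed
qed

text \<open>
  The functional \<open>L\<close> is a point of the weak* closure of \<open>T\<close>(ball).  The vectors of the ball whose images
  approximate \<open>L\<close> on finitely many functionals form nonempty convex sets, directed downwards.  Let \<open>d\<close> be
  the supremum over these sets of the infimum of \<open>q\<close>.  By the parallelogram law, near-minimisers over sets
  with infimum close to \<open>d\<close> are \<open>q\<close>-close to each other, so their images under \<open>T\<close> converge in norm.  The
  limit represents \<open>L\<close>, since any further functional can be added to the sets without moving the limit.
\<close>

lemma weak_limit_represented:
  fixes T :: "('a, 'k::{real_normed_field, banach}) linfc \<Rightarrow>\<^sub>L ('a, 'k) linfc"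
    and L :: "(('a, 'k) linfc \<Rightarrow>\<^sub>L 'k) \<Rightarrow> 'k"
    and q :: "('a, 'k) linfc \<Rightarrow> real"
  assumes q0: "\<And>x. 0 \<le> q x" and qB: "\<And>x. norm x \<le> 1 \<Longrightarrow> q x \<le> B"
    and par: "\<And>x y. q (x + y) + q (x - y) = 2 * q x + 2 * q y"
    and ctrl: "\<And>\<epsilon>. \<epsilon> > 0 \<Longrightarrow> \<exists>\<delta>>0. \<forall>x. norm x \<le> 1 \<longrightarrow> q x \<le> \<delta> \<longrightarrow> norm (T x) \<le> \<epsilon>"
    and L: "\<And>\<Phi> e. finite \<Phi> \<Longrightarrow> \<Phi> \<subseteq> functionals \<Longrightarrow> e > 0 \<Longrightarrow>
      \<exists>x. norm x \<le> 1 \<and> (\<forall>\<phi>\<in>\<Phi>. norm (blinfun_apply \<phi> (T x) - L \<phi>) \<le> e)"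
  shows "\<exists>y. \<forall>\<phi>\<in>functionals. blinfun_apply \<phi> y = L \<phi>"
proof -
  define U where "U \<Phi> e = {x. norm x \<le> 1 \<and> (\<forall>\<phi>\<in>\<Phi>. norm (blinfun_apply \<phi> (T x) - L \<phi>) \<le> e)}" for \<Phi> e
  define ok where "ok \<Phi> e \<longleftrightarrow> finite \<Phi> \<and> \<Phi> \<subseteq> functionals \<and> e > 0"
    for \<Phi> :: "(('a, 'k) linfc \<Rightarrow>\<^sub>L 'k) set" and e :: real
  have Une: "U \<Phi> e \<noteq> {}" if "ok \<Phi> e" for \<Phi> e
    using L[of \<Phi> e] that by (auto simp: U_def ok_def)
  have Umono: "U \<Phi>' e' \<subseteq> U \<Phi> e" if "\<Phi> \<subseteq> \<Phi>'" "e' \<le> e" for \<Phi> \<Phi>' e e'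
    using that by (fastforce simp: U_def)
  have Umid: "(1 / 2) *\<^sub>R (x + y) \<in> U \<Phi> e" if xy: "x \<in> U \<Phi> e" "y \<in> U \<Phi> e" for x y \<Phi> e
  proof -
    have "norm (x + y) \<le> 1 + 1"
      using xy by (intro norm_triangle_mono) (auto simp: U_def)
    moreover have "norm (blinfun_apply \<phi> (T ((1 / 2) *\<^sub>R (x + y))) - L \<phi>) \<le> e" if "\<phi> \<in> \<Phi>" for \<phi>
    proof -
      have "(blinfun_apply \<phi> (T x) - L \<phi>) + (blinfun_apply \<phi> (T y) - L \<phi>)
          = (blinfun_apply \<phi> (T x) + blinfun_apply \<phi> (T y)) - (L \<phi> + L \<phi>)"
        by simp
      then have "blinfun_apply \<phi> (T ((1 / 2) *\<^sub>R (x + y))) - L \<phi>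
          = (1 / 2) *\<^sub>R ((blinfun_apply \<phi> (T x) - L \<phi>) + (blinfun_apply \<phi> (T y) - L \<phi>))"
        by (simp only: blinfun.scaleR_right blinfun.add_right scaleR_diff_right scaleR_half_double)
      moreover have "norm ((blinfun_apply \<phi> (T x) - L \<phi>) + (blinfun_apply \<phi> (T y) - L \<phi>)) \<le> e + e"
        using xy that by (intro norm_triangle_mono) (auto simp: U_def)
      ultimately show ?thesis by simp
    qed
    ultimately show ?thesis by (simp add: U_def)
  qed
  define D where "D \<Phi> e = Inf (q ` U \<Phi> e)" for \<Phi> e
  have bdd: "bdd_below (q ` X)" for X by (rule bdd_belowI2[where m = 0]) (rule q0)
  have Dle: "D \<Phi> e \<le> q x" if "x \<in> U \<Phi> e" for x \<Phi> e
    unfolding D_def by (rule cINF_lower[OF bdd that])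
  have Dmono: "D \<Phi> e \<le> D \<Phi>' e'" if "ok \<Phi>' e'" "\<Phi> \<subseteq> \<Phi>'" "e' \<le> e" for \<Phi> \<Phi>' e e'
    unfolding D_def by (rule cINF_superset_mono[OF Une[OF that(1)] bdd Umono[OF that(2,3)]]) simp
  have DB: "D \<Phi> e \<le> B" if o: "ok \<Phi> e" for \<Phi> e
  proof -
    obtain x where x: "x \<in> U \<Phi> e" using Une[OF o] by blast
    then have "q x \<le> B" using qB by (simp add: U_def)
    then show ?thesis using Dle[OF x] by linarith
  qed
  define \<D> where "\<D> = {D \<Phi> e | \<Phi> e. ok \<Phi> e}"
  define d where "d = Sup \<D>"
  have bdd\<D>: "bdd_above \<D>" using DB by (intro bdd_aboveI[where M = B]) (auto simp: \<D>_def)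
  have "ok {} 1" by (simp add: ok_def)
  then have ne\<D>: "\<D> \<noteq> {}" by (auto simp: \<D>_def)
  have Dd: "D \<Phi> e \<le> d" if "ok \<Phi> e" for \<Phi> e
    unfolding d_def by (rule cSup_upper[OF _ bdd\<D>]) (use that in \<open>auto simp: \<D>_def\<close>)
  have near: "\<exists>\<Phi> e. ok \<Phi> e \<and> D \<Phi> e > d - \<tau>" if "\<tau> > 0" for \<tau>
  proof -
    have "d - \<tau> < Sup \<D>" using that by (simp add: d_def)
    then obtain v where "v \<in> \<D>" "d - \<tau> < v" using less_cSupD[OF ne\<D>] by blast
    then show ?thesis by (auto simp: \<D>_def)
  qed
  define \<tau> where "\<tau> n = 1 / real (Suc n)" for n
  have \<tau>0: "\<tau> n > 0" for n by (simp add: \<tau>_def)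
  have \<tau>mono: "\<tau> n \<le> \<tau> m" if "m \<le> n" for n m
    using that by (simp add: \<tau>_def frac_le)
  have \<tau>small: "\<exists>n. \<tau> n < e" if "e > 0" for e
    using nat_approx_posE[OF that] unfolding \<tau>_def by blast
  have "\<forall>n. \<exists>\<Phi> e. ok \<Phi> e \<and> D \<Phi> e > d - \<tau> n" using near \<tau>0 by blast
  then obtain \<Phi>0 e0 where \<Phi>0: "\<And>n. ok (\<Phi>0 n) (e0 n)" "\<And>n. D (\<Phi>0 n) (e0 n) > d - \<tau> n"
    by metis
  define \<Phi> where "\<Phi> n = (\<Union>j\<in>{..n}. \<Phi>0 j)" for n
  define r where "r n = Min (e0 ` {..n})" for n
  have ok: "ok (\<Phi> n) (r n)" for n
    using \<Phi>0(1) by (auto simp: ok_def \<Phi>_def r_def)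
  have decr: "U (\<Phi> m) (r m) \<subseteq> U (\<Phi> n) (r n)" if "n \<le> m" for n m
  proof (rule Umono)
    show "\<Phi> n \<subseteq> \<Phi> m" using that by (fastforce simp: \<Phi>_def)
    show "r m \<le> r n" unfolding r_def using that by (intro Min_antimono) auto
  qed
  have Dlow: "D (\<Phi> n) (r n) > d - \<tau> n" for n
  proof -
    have "D (\<Phi>0 n) (e0 n) \<le> D (\<Phi> n) (r n)"
      by (rule Dmono[OF ok]) (auto simp: \<Phi>_def r_def)
    then show ?thesis using \<Phi>0(2)[of n] by linarith
  qed
  have pick: "\<exists>x\<in>U \<Psi> e. q x < d + \<tau> n" if "ok \<Psi> e" for \<Psi> e n
  proof -
    have "Inf (q ` U \<Psi> e) < d + \<tau> n"
      using Dd[OF that] \<tau>0[of n] by (simp add: D_def)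
    then show ?thesis using cInf_lessD[of "q ` U \<Psi> e" "d + \<tau> n"] Une[OF that] by auto
  qed
  have q_0: "q 0 = 0" using par[of 0 0] by simp
  have qdouble: "q (x + x) = 4 * q x" for x using par[of x x] by (simp add: q_0)
  have qhalf: "q ((1 / 2) *\<^sub>R x) = q x / 4" for x
    using qdouble[of "(1 / 2) *\<^sub>R x"] by (simp flip: scaleR_add_left)
  \<comment> \<open>Near-minimisers are close: their midpoint lies in the same convex set.\<close>
  have close: "q ((1 / 2) *\<^sub>R (x - y)) \<le> 2 * \<tau> n"
    if x: "x \<in> U (\<Phi> n) (r n)" "q x < d + \<tau> n" and y: "y \<in> U (\<Phi> n) (r n)" "q y < d + \<tau> n"
    for x y n
  proof -
    have "d - \<tau> n < q ((1 / 2) *\<^sub>R (x + y))"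
      using Dle[OF Umid[OF x(1) y(1)]] Dlow[of n] by linarith
    then show ?thesis using par[of x y] x(2) y(2) by (simp add: qhalf)
  qed
  have Tclose: "\<exists>N. \<forall>n\<ge>N. \<forall>x y. x \<in> U (\<Phi> n) (r n) \<longrightarrow> q x < d + \<tau> n \<longrightarrow>
      y \<in> U (\<Phi> n) (r n) \<longrightarrow> q y < d + \<tau> n \<longrightarrow> norm (T x - T y) \<le> e" if e: "e > 0" for e
  proof -
    obtain \<delta> where \<delta>: "\<delta> > 0" "\<And>x. norm x \<le> 1 \<Longrightarrow> q x \<le> \<delta> \<Longrightarrow> norm (T x) \<le> e / 2"
      using ctrl[of "e / 2"] e by auto
    obtain N where N: "\<tau> N < \<delta> / 2" using \<tau>small[of "\<delta> / 2"] \<delta>(1) by auto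
    have "norm (T x - T y) \<le> e"
      if n: "n \<ge> N" and x: "x \<in> U (\<Phi> n) (r n)" "q x < d + \<tau> n"
        and y: "y \<in> U (\<Phi> n) (r n)" "q y < d + \<tau> n" for n x y
    proof -
      have "norm (x - y) \<le> 1 + 1"
        using x(1) y(1) norm_triangle_ineq4[of x y] by (simp add: U_def)
      moreover have "q ((1 / 2) *\<^sub>R (x - y)) \<le> \<delta>"
        using close[OF x y] N \<tau>mono[OF n] by linarith
      ultimately have "norm (T ((1 / 2) *\<^sub>R (x - y))) \<le> e / 2" by (intro \<delta>(2)) auto
      then show ?thesis by (simp add: blinfun.scaleR_right blinfun.diff_right)
    qed
    then show ?thesis by blast
  qed
  have "\<forall>n. \<exists>x. x \<in> U (\<Phi> n) (r n) \<and> q x < d + \<tau> n" using pick[OF ok] by blast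
  from choice[OF this] obtain x where x: "\<And>n. x n \<in> U (\<Phi> n) (r n)" "\<And>n. q (x n) < d + \<tau> n"
    by blast
  have "Cauchy (\<lambda>n. T (x n))"
  proof (rule CauchyI)
    fix e :: real assume e: "e > 0"
    obtain N where N: "\<And>n u v. n \<ge> N \<Longrightarrow> u \<in> U (\<Phi> n) (r n) \<Longrightarrow> q u < d + \<tau> n \<Longrightarrow>
        v \<in> U (\<Phi> n) (r n) \<Longrightarrow> q v < d + \<tau> n \<Longrightarrow> norm (T u - T v) \<le> e / 2"
      using Tclose[of "e / 2"] e by auto
    have "x n \<in> U (\<Phi> N) (r N)" "q (x n) < d + \<tau> N" if "n \<ge> N" for n
      using x[of n] decr[OF that] \<tau>mono[OF that] by auto
    then have "norm (T (x m) - T (x n)) \<le> e / 2" if "m \<ge> N" "n \<ge> N" for m n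
      using N[of N "x m" "x n"] that by blast
    then show "\<exists>M. \<forall>m\<ge>M. \<forall>n\<ge>M. norm (T (x m) - T (x n)) < e"
      using e by (intro exI[of _ N]) fastforce
  qed
  then obtain y where y: "(\<lambda>n. T (x n)) \<longlonglongrightarrow> y" using linfc_Cauchy_convergent by blast
  have "blinfun_apply \<phi> y = L \<phi>" if \<phi>: "\<phi> \<in> functionals" for \<phi>
  proof -
    have "norm (blinfun_apply \<phi> y - L \<phi>) \<le> e * (2 * norm \<phi> + 1)" if e: "e > 0" for e
    proof -
      obtain N where N: "\<And>n u v. n \<ge> N \<Longrightarrow> u \<in> U (\<Phi> n) (r n) \<Longrightarrow> q u < d + \<tau> n \<Longrightarrow>
          v \<in> U (\<Phi> n) (r n) \<Longrightarrow> q v < d + \<tau> n \<Longrightarrow> norm (T u - T v) \<le> e"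
        using Tclose[OF e] by blast
      obtain M where M: "\<And>n. n \<ge> M \<Longrightarrow> norm (T (x n) - y) < e"
        using LIMSEQ_D[OF y e] by blast
      define n where "n = max N M"
      have "ok (insert \<phi> (\<Phi> n)) (min (r n) e)" using ok[of n] \<phi> e by (simp add: ok_def)
      from pick[OF this, of n] obtain u where
        u: "u \<in> U (insert \<phi> (\<Phi> n)) (min (r n) e)" "q u < d + \<tau> n"
        by blast
      have "u \<in> U (\<Phi> n) (r n)"
        using u(1) Umono[of "\<Phi> n" "insert \<phi> (\<Phi> n)" "min (r n) e" "r n"] by auto
      then have "norm (T u - T (x n)) \<le> e"
        using N[of n u "x n"] u(2) x[of n] by (simp add: n_def)
      moreover have "norm (T (x n) - y) < e" using M[of n] by (simp add: n_def)
      ultimately have "norm (T u - y) \<le> 2 * e"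
        using norm_triangle_ineq[of "T u - T (x n)" "T (x n) - y"] by simp
      then have "norm \<phi> * norm (y - T u) \<le> norm \<phi> * (2 * e)"
        by (intro mult_left_mono) (auto simp: norm_minus_commute)
      then have "norm (blinfun_apply \<phi> y - blinfun_apply \<phi> (T u)) \<le> norm \<phi> * (2 * e)"
        using norm_blinfun[of \<phi> "y - T u"] by (simp add: blinfun.diff_right)
      moreover have "norm (blinfun_apply \<phi> (T u) - L \<phi>) \<le> e" using u(1) by (simp add: U_def)
      ultimately show ?thesis
        using norm_triangle_ineq[of "blinfun_apply \<phi> y - blinfun_apply \<phi> (T u)" "blinfun_apply \<phi> (T u) - L \<phi>"]
        by (simp add: algebra_simps)
    qed
    then have le: "norm (blinfun_apply \<phi> y - L \<phi>) \<le> e * (2 * norm \<phi> + 1)" if "e > 0" for e using that by blast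
    have "norm (blinfun_apply \<phi> y - L \<phi>) \<le> 0"
    proof (rule field_le_epsilon)
      fix e :: real assume "e > 0"
      moreover have "2 * norm \<phi> + 1 > 0" using norm_ge_zero[of \<phi>] by linarith
      ultimately show "norm (blinfun_apply \<phi> y - L \<phi>) \<le> 0 + e"
        using le[of "e / (2 * norm \<phi> + 1)"] by simp
    qed
    then show ?thesis by simp
  qed
  then show ?thesis by blast
qed

text \<open>
  The canonical map into a product of copies of the scalars.  Indexing the product by all real-linear
  functionals costs only constant coordinates, whence the value \<open>0\<close> off \<open>functionals\<close>.
\<close>

definition evaluations ::
    "('a, 'k::real_normed_field) linfc \<Rightarrow> (('a, 'k) linfc \<Rightarrow>\<^sub>L 'k) \<Rightarrow> 'k"
  where "evaluations y = (\<lambda>\<phi>. if \<phi> \<in> functionals then \<phi> y else 0)"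

lemma topspace_weak_topology:
  "topspace (weak_topology :: ('a, 'k::real_normed_field) linfc topology) = UNIV"
proof -
  have "(0 :: ('a, 'k::real_normed_field) linfc \<Rightarrow>\<^sub>L 'k) \<in> functionals"
    by (simp add: functionals_def)
  then have "UNIV \<in> {blinfun_apply \<phi> -` U | (\<phi> :: ('a, 'k) linfc \<Rightarrow>\<^sub>L 'k) U.
      \<phi> \<in> functionals \<and> open U}"
    by (intro CollectI exI[of _ 0] exI[of _ UNIV]) auto
  then show ?thesis unfolding weak_topology_def topology_generated_by_topspace by blast
qed

lemma continuous_map_evaluations:
  "continuous_map weak_topology euclidean
    (evaluations :: ('a, 'k::real_normed_field) linfc \<Rightarrow> _)"
proof -
  have "continuous_map weak_topology euclidean (\<lambda>y :: ('a, 'k) linfc. evaluations y \<phi>)" for \<phi>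
  proof (cases "\<phi> \<in> functionals")
    case True
    have "openin weak_topology {y. blinfun_apply \<phi> y \<in> V}" if "open V" for V
    proof -
      have "openin weak_topology (blinfun_apply \<phi> -` V)"
        unfolding weak_topology_def by (rule topology_generated_by_Basis) (use True that in blast)
      then show ?thesis by (simp add: vimage_def)
    qed
    then show ?thesis
      using True by (simp add: continuous_map_def topspace_weak_topology evaluations_def)
  next
    case False
    then show ?thesis by (simp add: evaluations_def)
  qed
  then have "continuous_map weak_topology (product_topology (\<lambda>_. euclidean) UNIV)
      (evaluations :: ('a, 'k) linfc \<Rightarrow> _)"
    by (simp add: continuous_map_componentwise_UNIV)
  then show ?thesis by (simp add: euclidean_product_topology)
qed

lemma openin_weak_topologyE:
  assumes "openin weak_topology W"
  shows "\<exists>V. open V \<and> W = evaluations -` V"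
proof -
  have "generate_topology_on {blinfun_apply \<phi> -` U | (\<phi> :: ('a, 'b) linfc \<Rightarrow>\<^sub>L 'b) U.
      \<phi> \<in> functionals \<and> open U} W"
    using assms unfolding weak_topology_def by (rule openin_topology_generated_by)
  then show ?thesis
  proof induction
    case Empty
    then show ?case by (intro exI[of _ "{}"]) simp
  next
    case (Int a b)
    then obtain V V' where "open V" "a = evaluations -` V" "open V'" "b = evaluations -` V'"
      by blast
    then show ?case by (intro exI[of _ "V \<inter> V'"]) auto
  next
    case (UN K)
    then have "\<forall>k\<in>K. \<exists>V. open V \<and> k = evaluations -` V" by blast
    from bchoice[OF this] obtain V where "\<forall>k\<in>K. open (V k) \<and> k = evaluations -` V k" by blast
    then show ?case by (intro exI[of _ "\<Union>k\<in>K. V k"]) auto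
  next
    case (Basis s)
    then obtain \<phi> U where s: "s = blinfun_apply \<phi> -` U" "\<phi> \<in> functionals" "open U" by blast
    have "open ((\<lambda>f :: (('a, 'b) linfc \<Rightarrow>\<^sub>L 'b) \<Rightarrow> 'b. f \<phi>) -` U)"
      by (rule open_vimage[OF s(3) continuous_on_product_coordinates])
    moreover have "s = evaluations -` ((\<lambda>f. f \<phi>) -` U)"
      using s by (auto simp: evaluations_def)
    ultimately show ?case by blast
  qed
qed

text \<open>
  The weak topology is the pullback of the product topology along \<open>evaluations\<close>.  Hence the weak closure
  of \<open>S\<close> is the preimage of the closure of its image, and a cover of the former is a cover of the latter
  once the latter lies in the range.
\<close>

lemma weakly_compactI:
  fixes S :: "('a, 'k::real_normed_field) linfc set"
  assumes C: "compact (closure (evaluations ` S))"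
    and rng: "closure (evaluations ` S) \<subseteq> range evaluations"
  shows "compactin weak_topology (weak_topology closure_of S)"
  unfolding compactin_def
proof (intro conjI allI impI)
  let ?C = "closure (evaluations ` S)"
  show "weak_topology closure_of S \<subseteq> topspace weak_topology" by (rule closure_of_subset_topspace)
  fix \<U> :: "('a, 'k) linfc set set"
  assume "(\<forall>U\<in>\<U>. openin weak_topology U) \<and> weak_topology closure_of S \<subseteq> \<Union> \<U>"
  then have op: "\<forall>U\<in>\<U>. openin weak_topology U" and cov: "weak_topology closure_of S \<subseteq> \<Union> \<U>"
    by auto
  have "\<forall>U\<in>\<U>. \<exists>V. open V \<and> U = evaluations -` V"
    by (intro ballI openin_weak_topologyE op[rule_format])
  from bchoice[OF this] obtain V where "\<forall>U\<in>\<U>. open (V U) \<and> U = evaluations -` V U" by blast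
  then have V: "\<And>U. U \<in> \<U> \<Longrightarrow> open (V U)"
    and VU: "\<And>U y. U \<in> \<U> \<Longrightarrow> y \<in> U \<longleftrightarrow> evaluations y \<in> V U"
    by (blast, metis vimage_eq)
  have inC: "y \<in> weak_topology closure_of S \<longleftrightarrow> evaluations y \<in> ?C" for y
  proof
    assume "y \<in> weak_topology closure_of S"
    then have "evaluations y \<in> euclidean closure_of (evaluations ` S)"
      using continuous_map_image_closure_subset[OF continuous_map_evaluations, of S] by blast
    then show "evaluations y \<in> ?C" by simp
  next
    assume y: "evaluations y \<in> ?C"
    show "y \<in> weak_topology closure_of S"
      unfolding in_closure_of
    proof (intro conjI allI impI)
      fix W assume W: "y \<in> W \<and> openin weak_topology W"
      then obtain V where V: "open V" "W = evaluations -` V" using openin_weak_topologyE by blast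
      then have "V \<inter> evaluations ` S \<noteq> {}"
        using W y open_Int_closure_eq_empty[of V "evaluations ` S"] by blast
      then show "\<exists>y. y \<in> S \<and> y \<in> W" using V by blast
    qed (simp add: topspace_weak_topology)
  qed
  have "?C \<subseteq> (\<Union>U\<in>\<U>. V U)"
  proof
    fix c assume c: "c \<in> ?C"
    then obtain y where y: "c = evaluations y" using rng by blast
    then have "y \<in> weak_topology closure_of S" using c inC by simp
    then obtain U where U: "U \<in> \<U>" "y \<in> U" using cov by blast
    then show "c \<in> (\<Union>U\<in>\<U>. V U)" using VU[OF U(1), of y] y by blast
  qed
  from compactE_image[OF C V this] obtain \<F> where
    F: "\<F> \<subseteq> \<U>" "finite \<F>" "?C \<subseteq> (\<Union>U\<in>\<F>. V U)"
    by metis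
  have "weak_topology closure_of S \<subseteq> \<Union> \<F>"
  proof
    fix y assume "y \<in> weak_topology closure_of S"
    then have "evaluations y \<in> ?C" using inC by blast
    then obtain U where U: "U \<in> \<F>" "evaluations y \<in> V U" using F(3) by blast
    then have "y \<in> U" using VU[of U y] F(1) by blast
    then show "y \<in> \<Union> \<F>" using U(1) by blast
  qed
  then show "\<exists>\<F>. finite \<F> \<and> \<F> \<subseteq> \<U> \<and> weak_topology closure_of S \<subseteq> \<Union> \<F>"
    using F by blast
qed

text \<open>
  By Tychonoff's theorem the closure of the image of \<open>T\<close>(ball) in the product is compact; the form \<open>q\<close>
  ensures that it contains no points outside \<open>X\<close>.
\<close>

lemma exhaustive_imp_weakly_compact:
  fixes T :: "('a, 'k::{real_normed_field, euclidean_space}) linfc \<Rightarrow>\<^sub>L ('a, 'k) linfc"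
  assumes T: "T \<in> operators"
    and ex: "\<And>E e. disjoint_family E \<Longrightarrow> e > 0 \<Longrightarrow> \<exists>n::nat. \<forall>\<gamma>. mass (component T \<gamma>) (E n) \<le> e"
  shows "T \<in> weakly_compact_operators"
proof -
  obtain q :: "('a, 'k) linfc \<Rightarrow> real" and B where q: "\<forall>x. 0 \<le> q x"
    "\<forall>x. norm x \<le> 1 \<longrightarrow> q x \<le> B" "\<forall>x y. q (x + y) + q (x - y) = 2 * q x + 2 * q y"
    "\<forall>\<epsilon>>0. \<exists>\<delta>>0. \<forall>x. norm x \<le> 1 \<longrightarrow> q x \<le> \<delta> \<longrightarrow> norm (T x) \<le> \<epsilon>"
    using hilbertian_control[OF T ex] by blast
  let ?S = "T ` cball 0 1"
  let ?C = "closure (evaluations ` ?S)"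
  let ?K = "\<Pi>\<^sub>E \<phi>\<in>UNIV. cball (0 :: 'k) (norm \<phi> * norm T)"
  have "compactin (product_topology (\<lambda>_. euclidean) UNIV) ?K"
    by (simp add: compactin_PiE)
  then have K: "compact ?K" by (simp add: euclidean_product_topology)
  have "closedin (product_topology (\<lambda>_. euclidean) UNIV) ?K"
    by (simp add: closedin_product_topology)
  then have Kc: "closed ?K" by (simp add: euclidean_product_topology)
  have "evaluations (T x) \<phi> \<in> cball 0 (norm \<phi> * norm T)" if "norm x \<le> 1" for x \<phi>
  proof -
    have "norm (\<phi> (T x)) \<le> norm \<phi> * (norm T * norm x)"
      using norm_blinfun[of \<phi> "T x"] mult_left_mono[OF norm_blinfun[of T x], of "norm \<phi>"] by simp
    also have "\<dots> \<le> norm \<phi> * (norm T * 1)" by (intro mult_left_mono that) auto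
    finally show ?thesis by (simp add: evaluations_def)
  qed
  then have "evaluations ` ?S \<subseteq> ?K" by auto
  then have CK: "?C \<subseteq> ?K" by (rule closure_minimal[OF _ Kc])
  have C: "compact ?C" using compact_Int_closed[OF K closed_closure, of "evaluations ` ?S"] CK
    by (simp add: Int_absorb1)
  have "L \<in> range evaluations" if L: "L \<in> ?C" for L
  proof -
    have approx: "\<exists>x. norm x \<le> 1 \<and> (\<forall>\<phi>\<in>\<Phi>. norm (evaluations (T x) \<phi> - L \<phi>) < e)"
      if "finite \<Phi>" "e > 0" for \<Phi> e
    proof -
      define V where "V = (\<Inter>\<phi>\<in>\<Phi>. (\<lambda>f :: (('a, 'k) linfc \<Rightarrow>\<^sub>L 'k) \<Rightarrow> 'k. f \<phi>) -` ball (L \<phi>) e)"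
      have "open V"
        unfolding V_def
        by (intro open_INT that(1) ballI open_vimage open_ball continuous_on_product_coordinates)
      moreover have "L \<in> V" using that(2) by (simp add: V_def)
      ultimately have "V \<inter> evaluations ` ?S \<noteq> {}"
        using L open_Int_closure_eq_empty[of V "evaluations ` ?S"] by blast
      then obtain x where "norm x \<le> 1" "evaluations (T x) \<in> V" by auto
      then show ?thesis
        by (intro exI[of _ x]) (auto simp: V_def dist_norm norm_minus_commute)
    qed
    have off: "L \<phi> = 0" if "\<phi> \<notin> functionals" for \<phi>
    proof (rule ccontr)
      assume "L \<phi> \<noteq> 0"
      then obtain x where "norm (evaluations (T x) \<phi> - L \<phi>) < norm (L \<phi>)"
        using approx[of "{\<phi>}" "norm (L \<phi>)"] by auto
      then show False using that by (simp add: evaluations_def)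
    qed
    have "\<exists>y. \<forall>\<phi>\<in>functionals. blinfun_apply \<phi> y = L \<phi>"
    proof (rule weak_limit_represented[where q = q and B = B and T = T])
      fix \<Phi> :: "(('a, 'k) linfc \<Rightarrow>\<^sub>L 'k) set" and e :: real
      assume \<Phi>: "finite \<Phi>" "\<Phi> \<subseteq> functionals" "e > 0"
      then obtain x where x: "norm x \<le> 1" "\<forall>\<phi>\<in>\<Phi>. norm (evaluations (T x) \<phi> - L \<phi>) < e"
        using approx[of \<Phi> e] by blast
      have "norm (blinfun_apply \<phi> (T x) - L \<phi>) \<le> e" if "\<phi> \<in> \<Phi>" for \<phi>
      proof -
        have "evaluations (T x) \<phi> = blinfun_apply \<phi> (T x)"
          using \<Phi>(2) that by (auto simp: evaluations_def)
        then show ?thesis using x(2) that by (metis less_imp_le)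
      qed
      then show "\<exists>x. norm x \<le> 1 \<and> (\<forall>\<phi>\<in>\<Phi>. norm (blinfun_apply \<phi> (T x) - L \<phi>) \<le> e)"
        using x(1) by blast
    qed (use q in blast)+
    then obtain y where "\<forall>\<phi>\<in>functionals. blinfun_apply \<phi> y = L \<phi>" by blast
    then have "L = evaluations y" using off by (auto simp: evaluations_def fun_eq_iff)
    then show ?thesis by blast
  qed
  then have "compactin weak_topology (weak_topology closure_of ?S)"
    by (intro weakly_compactI[OF C]) blast
  then show ?thesis using T by (simp add: weakly_compact_operators_def)
qed

section \<open>The closed ideals\<close>

lemma not_bounded_below_on_copies_iff:
  fixes F :: "('b, 'k::real_normed_field) linfc set"
    and T :: "('a, 'k) linfc \<Rightarrow>\<^sub>L ('a, 'k) linfc"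
  shows "T \<in> \<S> F \<longleftrightarrow> T \<in> operators \<and>
    (\<forall>E. isomorphic_spaces E F \<longrightarrow> K_subspace E \<longrightarrow>
      (\<forall>c>0. \<exists>x\<in>E. norm (T x) < c * norm x))"
  unfolding not_bounded_below_on_copies_def mem_Collect_eq
  by (intro conj_cong refl) (simp add: not_le)

text \<open>
  Diagonal dominance selects \<open>\<kappa>\<close> many distinct coordinates, more than there are.
\<close>

lemma no_larger_copy:
  fixes T :: "('a, 'k::real_normed_field) linfc \<Rightarrow>\<^sub>L ('a, 'k) linfc" and \<kappa> :: "'b rel"
  assumes T: "T \<in> operators" and \<kappa>: "Cinfinite \<kappa>" "|UNIV :: 'a set| <o \<kappa>"
  shows "T \<in> \<S> (linfc_card \<kappa> :: ('b, 'k) linfc set)"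
proof (rule ccontr)
  assume "\<not> ?thesis"
  then have "\<not> (\<forall>E :: ('a, 'k) linfc set.
      \<not> (isomorphic_spaces E (linfc_card \<kappa> :: ('b, 'k) linfc set) \<and> K_subspace E))"
    using T by (simp add: not_bounded_below_on_copies_iff) blast
  then obtain E :: "('a, 'k) linfc set" where
    E: "K_subspace E" "isomorphic_spaces E (linfc_card \<kappa> :: ('b, 'k) linfc set)"
    by blast
  obtain S :: "('b, 'k) linfc \<Rightarrow>\<^sub>L ('a, 'k) linfc" and d where S: "K_linear S" "d > 0"
    "\<And>z. z \<in> linfc_card \<kappa> \<Longrightarrow> d * norm z \<le> norm (S z)"
    by (rule copy_embedding[OF E]) blast
  have inf: "infinite (Field \<kappa>)" using \<kappa>(1) unfolding cinfinite_def by blast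
  have large: "d / 2 < norm (S (unit_vec i))" if "i \<in> Field \<kappa>" for i
    using S(3)[OF unit_vec_in_linfc_card[OF that]] S(2) by simp
  have d2: "d / 2 > 0" using S(2) by simp
  have "\<forall>i\<in>Field \<kappa>. d / 2 < norm (S (unit_vec i))" using large by blast
  with diagonal_dominance[OF S(1) inf d2 zero_less_one]
  have "\<exists>J (\<gamma> :: 'b \<Rightarrow> 'a). J \<subseteq> Field \<kappa> \<and> |J| =o |Field \<kappa>| \<and> inj_on \<gamma> J"
    by (metis (no_types, lifting))
  then obtain J and \<gamma> :: "'b \<Rightarrow> 'a" where
    J: "J \<subseteq> Field \<kappa>" "|J| =o |Field \<kappa>|" "inj_on \<gamma> J"
    by blast
  have "|J| \<le>o |UNIV :: 'a set|" using J(3) card_of_ordLeq[of J "UNIV :: 'a set"] by auto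
  moreover have "|J| =o \<kappa>"
    using J(2) card_of_Field_ordIso[of \<kappa>] \<kappa>(1) ordIso_transitive by blast
  ultimately have "\<kappa> \<le>o |UNIV :: 'a set|" using ordIso_symmetric ordIso_ordLeq_trans by blast
  then show False using \<kappa>(2) not_ordLess_ordLeq by blast
qed

theorem closed_ideal_classification:
  fixes I :: "(('a, 'k::{real_normed_field, euclidean_space}) linfc \<Rightarrow>\<^sub>L ('a, 'k) linfc) set"
  assumes inf: "infinite (UNIV :: 'a set)"
    and I: "operator_ideal I" "closed I" "weakly_compact_operators \<subseteq> I"
  shows "\<exists>\<kappa> :: 'a set rel. Cinfinite \<kappa> \<and> \<kappa> \<le>o cardSuc |UNIV :: 'a set| \<and> I = \<S> (linfc_card \<kappa>)"
proof -
  have Iop: "I \<subseteq> operators"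
    and IA: "\<And>T A. T \<in> I \<Longrightarrow> A \<in> operators \<Longrightarrow> A o\<^sub>L T \<in> I"
    using I(1) by (auto simp: operator_ideal_def)
  show ?thesis
  proof (cases "\<exists>A. infinite A \<and> proj A \<notin> I")
    case False
    then have "proj UNIV \<in> I" using inf by blast
    moreover have "T o\<^sub>L proj UNIV = T" for T :: "('a, 'k) linfc \<Rightarrow>\<^sub>L ('a, 'k) linfc"
    proof (rule blinfun_eqI)
      fix z :: "('a, 'k) linfc"
      have "proj UNIV z = z" by (rule linfc_eqI) simp
      then show "(T o\<^sub>L proj UNIV) z = T z" by simp
    qed
    ultimately have Iall: "I = operators" using IA Iop by (metis subsetI subset_antisym)
    let ?\<kappa> = "cardSuc |UNIV :: 'a set|"
    have ci: "Cinfinite ?\<kappa>"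
      by (rule Cinfinite_cardSuc) (use inf card_of_Card_order[of "UNIV :: 'a set"] in
          \<open>simp only: cinfinite_def Field_card_of simp_thms\<close>)
    have "|UNIV :: 'a set| <o ?\<kappa>" by (intro cardSuc_greater card_of_Card_order)
    then have "(operators :: (('a, 'k) linfc \<Rightarrow>\<^sub>L ('a, 'k) linfc) set)
        \<subseteq> \<S> (linfc_card ?\<kappa> :: ('a set, 'k) linfc set)"
      by (intro subsetI no_larger_copy ci)
    moreover have "\<S> (linfc_card ?\<kappa> :: ('a set, 'k) linfc set)
        \<subseteq> (operators :: (('a, 'k) linfc \<Rightarrow>\<^sub>L ('a, 'k) linfc) set)"
      by (simp add: subset_iff not_bounded_below_on_copies_iff)
    ultimately have "I = \<S> (linfc_card ?\<kappa> :: ('a set, 'k) linfc set)"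
      unfolding Iall by (rule subset_antisym)
    moreover have "?\<kappa> \<le>o ?\<kappa>" by (intro ordLeq_refl cardSuc_Card_order card_of_Card_order)
    ultimately show ?thesis using ci by blast
  next
    case True
    define R where "R = {|A| | A :: 'a set. infinite A \<and> proj A \<notin> I}"
    have "R \<noteq> {}" using True by (auto simp: R_def)
    moreover have "\<forall>r\<in>R. Card_order r" by (auto simp: R_def card_of_Card_order)
    ultimately obtain r where r: "r \<in> R" "\<forall>r'\<in>R. r \<le>o r'" using exists_minim_Card_order by blast
    then obtain A where A: "infinite A" "proj A \<notin> I" "r = |A|" by (auto simp: R_def)
    have min: "proj B \<in> I" if "infinite B" "|B| <o |A|" for B
    proof (rule ccontr)
      assume "proj B \<notin> I"
      then have "|A| \<le>o |B|" using r(2) A(3) that(1) by (auto simp: R_def)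
      then show False using that(2) not_ordLess_ordLeq by blast
    qed
    \<comment> \<open>A copy of \<open>|A|\<close> on singletons, since \<open>\<kappa>\<close> has to live on the type that also hosts \<open>\<lambda>\<^sup>+\<close>.\<close>
    define \<kappa> where "\<kappa> = |(\<lambda>a. {a}) ` A|"
    have F\<kappa>: "Field \<kappa> = (\<lambda>a. {a}) ` A" by (simp add: \<kappa>_def Field_card_of)
    have "bij_betw (\<lambda>a. {a}) A ((\<lambda>a. {a}) ` A)" by (rule bij_betw_imageI) auto
    then have iso: "\<kappa> =o |A|" unfolding \<kappa>_def using card_of_ordIso ordIso_symmetric by blast
    have inf\<kappa>: "infinite (Field \<kappa>)" unfolding F\<kappa> using A(1) by (simp add: finite_image_iff)
    have ci: "Cinfinite \<kappa>"
      using inf\<kappa> card_of_Card_order[of "(\<lambda>a. {a}) ` A"]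
      unfolding cinfinite_def \<kappa>_def[symmetric] by blast
    have "|A| \<le>o |UNIV :: 'a set|" by (rule card_of_mono1) simp
    then have le: "\<kappa> \<le>o cardSuc |UNIV :: 'a set|"
      using iso cardSuc_ordLeq[OF card_of_Card_order] ordIso_ordLeq_trans ordLeq_transitive by blast
    have "I \<subseteq> \<S> (linfc_card \<kappa>)"
    proof
      fix T assume T: "T \<in> I"
      from iso have FA: "|Field \<kappa>| =o |A|" unfolding F\<kappa> by (simp only: \<kappa>_def)
      have "\<exists>x\<in>E. norm (T x) < c * norm x"
        if E: "isomorphic_spaces E (linfc_card \<kappa> :: ('a set, 'k) linfc set)" "K_subspace E" "c > 0"
        for E c
      proof (rule ccontr)
        assume "\<not> ?thesis"
        then have "\<And>x. x \<in> E \<Longrightarrow> c * norm x \<le> norm (T x)" by (simp add: not_less)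
        from projection_in_ideal[OF I(1,2) T E(2,1,3) this A(1) FA] show False using A(2) by blast
      qed
      then show "T \<in> \<S> (linfc_card \<kappa>)"
        using T Iop by (simp add: not_bounded_below_on_copies_iff subset_iff)
    qed
    moreover have "T \<in> I" if T: "T \<in> \<S> (linfc_card \<kappa> :: ('a set, 'k) linfc set)" for T
    proof (cases "countable (Field \<kappa>)")
      case True
      have "T \<in> weakly_compact_operators"
      proof (rule exhaustive_imp_weakly_compact)
        show "T \<in> operators" using T by (simp add: not_bounded_below_on_copies_iff)
      qed (rule fixes_no_countable_copy_imp_exhaustive[OF T inf\<kappa> True])
      then show ?thesis using I(3) by blast
    next
      case False
      have Top: "T \<in> operators" using T by (simp add: not_bounded_below_on_copies_iff)
      have F: "|Field \<kappa>| =o \<kappa>" using ci by (intro card_of_Field_ordIso) simp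
      have unc: "natLeq <o \<kappa>"
      proof -
        have "\<not> |Field \<kappa>| \<le>o natLeq" using False by (simp add: countable_card_le_natLeq)
        then have "natLeq <o |Field \<kappa>|"
          using not_ordLeq_iff_ordLess[OF natLeq_Well_order card_of_Well_order] by blast
        then show ?thesis using F by (rule ordLess_ordIso_trans)
      qed
      \<comment> \<open>Minimality of \<open>A\<close> concerns infinite sets only, so the small support gets enlarged by \<open>N\<close>.\<close>
      obtain N :: "'a set" where N: "infinite N" "countable N"
        using infinite_countable_subset'[OF inf] by blast
      have "|N| <o |A|"
        using N(2) unc iso ordLess_ordIso_trans ordLeq_ordLess_trans
        unfolding countable_card_le_natLeq by blast
      have "\<exists>B\<in>I. dist B T < \<epsilon>" if \<epsilon>: "\<epsilon> > 0" for \<epsilon>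
      proof -
        have "\<epsilon> / 2 > 0" using \<epsilon> by simp
        from small_support_approximation[OF T ci unc this] obtain C where
          C: "|C| <o \<kappa>" "norm (T - (T o\<^sub>L proj C)) \<le> \<epsilon> / 2" by blast
        have "|C| <o |A|" using C(1) iso ordLess_ordIso_trans by blast
        then have "|C \<union> N| <o |A|"
          using \<open>|N| <o |A|\<close> card_of_Un_ordLess_infinite[OF A(1)] by blast
        then have "proj (C \<union> N) \<in> I" by (intro min) (use N(1) in auto)
        then have "(T o\<^sub>L proj C) o\<^sub>L proj (C \<union> N) \<in> I"
          using K_linear_compose[of T "proj C"] Top K_linear_proj
          by (intro IA) (auto simp: K_linear_iff_operators)
        moreover have "(T o\<^sub>L proj C) o\<^sub>L proj (C \<union> N) = T o\<^sub>L proj C"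
        proof (rule blinfun_eqI)
          fix z :: "('a, 'k) linfc"
          have "proj C (proj (C \<union> N) z) = proj C z" by (rule linfc_eqI) simp
          then show "((T o\<^sub>L proj C) o\<^sub>L proj (C \<union> N)) z = (T o\<^sub>L proj C) z" by simp
        qed
        ultimately have "T o\<^sub>L proj C \<in> I" by simp
        moreover have "dist (T o\<^sub>L proj C) T < \<epsilon>"
          using C(2) \<epsilon> by (simp add: dist_norm norm_minus_commute)
        ultimately show ?thesis by blast
      qed
      then have "T \<in> closure I" by (auto simp: closure_approachable)
      then show ?thesis using I(2) by simp
    qed
    ultimately show ?thesis using ci le by blast
  qed
qed

theorem theorem1p2:
  assumes "infinite (UNIV :: 'a set)"
  shows
    "(\<forall>I :: (('a, real) linfc \<Rightarrow>\<^sub>L ('a, real) linfc) set.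
        operator_ideal I \<and> closed I \<and> weakly_compact_operators \<subseteq> I \<longrightarrow>
        (\<exists>\<kappa> :: 'a set rel. Cinfinite \<kappa> \<and> \<kappa> \<le>o cardSuc |UNIV :: 'a set| \<and> I = \<S> (linfc_card \<kappa>))) \<and>
     (\<forall>I :: (('a, complex) linfc \<Rightarrow>\<^sub>L ('a, complex) linfc) set.
        operator_ideal I \<and> closed I \<and> weakly_compact_operators \<subseteq> I \<longrightarrow>
        (\<exists>\<kappa> :: 'a set rel. Cinfinite \<kappa> \<and> \<kappa> \<le>o cardSuc |UNIV :: 'a set| \<and> I = \<S> (linfc_card \<kappa>)))"
proof (intro conjI allI impI)
  fix I :: "(('a, real) linfc \<Rightarrow>\<^sub>L ('a, real) linfc) set"
  assume "operator_ideal I \<and> closed I \<and> weakly_compact_operators \<subseteq> I"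
  then show "\<exists>\<kappa> :: 'a set rel. Cinfinite \<kappa> \<and> \<kappa> \<le>o cardSuc |UNIV :: 'a set| \<and>
      I = \<S> (linfc_card \<kappa>)"
    by (elim conjE) (rule closed_ideal_classification[OF assms])
next
  fix I :: "(('a, complex) linfc \<Rightarrow>\<^sub>L ('a, complex) linfc) set"
  assume "operator_ideal I \<and> closed I \<and> weakly_compact_operators \<subseteq> I"
  then show "\<exists>\<kappa> :: 'a set rel. Cinfinite \<kappa> \<and> \<kappa> \<le>o cardSuc |UNIV :: 'a set| \<and>
      I = \<S> (linfc_card \<kappa>)"
    by (elim conjE) (rule closed_ideal_classification[OF assms])
qed

end
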